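(* Let $L$ be the rank-three matroid with $16$ lines (labelled $1,\dots,16$) and $38$ points (labelled $1,\dots,38$) in which the lines $1,\dots,16$ contain, respectively, the following sets of points: line 1: $\{1,29,30,31,32,33,34,35,36,37,38\}$; line 2: $\{2,5,12,15,26,28,35\}$; line 3: $\{2,11,21,22,23,25,36\}$; line 4: $\{3,4,5,6,9,23,33\}$; line 5: $\{3,7,10,11,16,26,30\}$; line 6: $\{2,6,13,16,17,24,38\}$; line 7: $\{2,8,9,10,18,19,31\}$; line 8: $\{2,4,7,14,20,27,37\}$; line 9: $\{3,12,19,20,21,24,29\}$; line 10: $\{3,8,13,14,15,22,34\}$; line 11: $\{3,17,18,25,27,28,32\}$; line 12: $\{1,6,8,21,26,27\}$; line 13: $\{1,5,10,17,20,22\}$; line 14: $\{1,7,12,13,18,23\}$; line 15: $\{1,4,15,16,19,25\}$; line 16: $\{1,9,11,14,24,28\}$. Then $L$ is combinatorially simplicial, $g(L)=5$, the moduli space $\mathcal{V}_{\mathbb{C}}(L)$ is $1$-dimensional, and $L$ has no realization over $\mathbb{R}$.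
   Context: Matroids of rank three are viewed as (abstract) intersection lattices of line arrangements in a projective plane: the elements of the ground set are called lines, and the rank-two flats are called points (a point is identified with the set of lines containing it); any two distinct lines lie on exactly one common point. All matroids are simple. Combinatorially simplicial: for a rank-three matroid $L$ put $\sigma(L)=3+\sum_{v}(|v|-3)$, where $v$ runs over all points and $|v|$ is the number of lines through $v$. $L$ is combinatorially simplicial if $\sigma(L)=0$. Generation: lines $H_1,\dots,H_n$ of $L$ generate $L$ if there is a sequence $U_1,\dots,U_m$ of points and lines of $L$ such that (1) $U_i=H_i$ for $i=1,\dots,n$; (2) for all $i>n$ there exist $j,k<i$ such that $U_i$ is either the intersection point $U_j\cap U_k$ of two distinct lines $U_j,U_k$ or the line $U_j+U_k$ of $L$ through two distinct points $U_j,U_k$; (3) every line of $L$ is in $\{U_1,\dots,U_m\}$. Put $g(L):=\min\{n\in\mathbb{N}\mid L\text{ is generated by } n \text{ lines}\}$. Moduli space: for a field $K$ and a rank-three matroid $L$ on $\{1,\dots,\ell\}$, let $\mathcal{U}(L)$ be the set of matrices $M=[m_1,\dots,m_\ell]\in K^{3\times\ell}$ such that the kernels $\ker(m_i)$ of the linear forms on $K^3$ given by the columns are $\ell$ distinct hyperplanes and sending $i$ to $\ker(m_i)$ extends to an isomorphism of graded lattices from $L$ to the intersection lattice of $\{\ker(m_1),\dots,\ker(m_\ell)\}$ (equivalently, the $m_i$ are a vector realization of the labelled matroid). Then $\mathcal{V}_K(L):=\mathrm{PGL}(3,K)\backslash(\mathcal{U}(L)/(K^\times)^\ell)$, where $(K^\times)^\ell$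 acts by rescaling columns. $L$ has a realization over $K$ if $\mathcal{U}(L)\ne\emptyset$. *)

theory Defs
  imports "HOL-Analysis.Analysis"
begin

section \<open>Matroids of rank three\<close>

text \<open>A simple matroid of rank three, given by its ground set (of lines) and its rank-two flats
  (points), a point being identified with the set of lines through it.\<close>

record 'l matroid3 =
  lines :: "'l set"
  points :: "'l set set"

definition rank_three_matroid :: "'l matroid3 \<Rightarrow> bool" where
  "rank_three_matroid L \<longleftrightarrow>
     finite (lines L) \<and> 3 \<le> card (lines L) \<and>
     (\<forall>v\<in>points L. v \<subset> lines L \<and> 2 \<le> card v) \<and>
     (\<forall>a\<in>lines L. \<forall>b\<in>lines L. a \<noteq> b \<longrightarrow> (\<exists>!v. v \<in> points L \<and> a \<in> v \<and> b \<in> v))"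

definition sigma :: "'l matroid3 \<Rightarrow> int" where
  "sigma L = 3 + (\<Sum>v\<in>points L. int (card v) - 3)"

definition combinatorially_simplicial :: "'l matroid3 \<Rightarrow> bool" where
  "combinatorially_simplicial L \<longleftrightarrow> sigma L = 0"


section \<open>Generation\<close>

text \<open>In a sequence of points and lines, \<open>Inl a\<close> is the line \<open>a\<close> and \<open>Inr v\<close> is the point \<open>v\<close>.\<close>

definition is_intersection_point :: "'l matroid3 \<Rightarrow> 'l + 'l set \<Rightarrow> 'l + 'l set \<Rightarrow> 'l + 'l set \<Rightarrow> bool" where
  "is_intersection_point L X Y Z \<longleftrightarrow>
     (\<exists>a\<in>lines L. \<exists>b\<in>lines L. \<exists>v\<in>points L.
        a \<noteq> b \<and> X = Inl a \<and> Y = Inl b \<and> a \<in> v \<and> b \<in> v \<and> Z = Inr v)"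

definition is_joining_line :: "'l matroid3 \<Rightarrow> 'l + 'l set \<Rightarrow> 'l + 'l set \<Rightarrow> 'l + 'l set \<Rightarrow> bool" where
  "is_joining_line L X Y Z \<longleftrightarrow>
     (\<exists>v\<in>points L. \<exists>w\<in>points L. \<exists>a\<in>lines L.
        v \<noteq> w \<and> X = Inr v \<and> Y = Inr w \<and> a \<in> v \<and> a \<in> w \<and> Z = Inl a)"

definition generates :: "'l matroid3 \<Rightarrow> 'l list \<Rightarrow> bool" where
  "generates L Hs \<longleftrightarrow> set Hs \<subseteq> lines L \<and>
     (\<exists>Us. length Hs \<le> length Us \<and>
        (\<forall>i<length Hs. Us ! i = Inl (Hs ! i)) \<and>
        (\<forall>i. length Hs \<le> i \<and> i < length Us \<longrightarrow>
           (\<exists>j<i. \<exists>k<i. is_intersection_point L (Us ! j) (Us ! k) (Us ! i) \<or>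
                        is_joining_line L (Us ! j) (Us ! k) (Us ! i))) \<and>
        (\<forall>a\<in>lines L. Inl a \<in> set Us))"

definition generation_number :: "'l matroid3 \<Rightarrow> nat" where
  "generation_number L = (LEAST n. \<exists>Hs. length Hs = n \<and> generates L Hs)"


section \<open>Realizations\<close>

definition flats :: "'l matroid3 \<Rightarrow> 'l set set" where
  "flats L = {{}} \<union> (\<lambda>i. {i}) ` lines L \<union> points L \<union> {lines L}"

definition form_ker :: "'k::field ^ 'n \<Rightarrow> ('k ^ 'n) set" where
  "form_ker m = {x. scalar_product m x = 0}"

text \<open>The empty intersection is the whole space; the lattice is ordered by reverse inclusion.\<close>

definition intersection_lattice :: "('k ^ 'n) set set \<Rightarrow> ('k ^ 'n) set set" where
  "intersection_lattice A = {\<Inter>B | B. B \<subseteq> A}"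

text \<open>A matrix with three rows and with columns indexed by \<open>E\<close> is the family of its columns.\<close>

definition matrices :: "'l set \<Rightarrow> ('l \<Rightarrow> 'k ^ 3) set" where
  "matrices E = (E \<rightarrow>\<^sub>E UNIV)"

text \<open>The rank of a flat is the length of a maximal chain below it, so that every order isomorphism
  between the two lattices is one of graded lattices.\<close>

definition realizations :: "'l matroid3 \<Rightarrow> ('l \<Rightarrow> 'k::field ^ 3) set" where
  "realizations L = {M \<in> matrices (lines L).
     (\<forall>i\<in>lines L. M i \<noteq> 0) \<and> inj_on (\<lambda>i. form_ker (M i)) (lines L) \<and>
     (\<exists>\<phi>. bij_betw \<phi> (flats L) (intersection_lattice ((\<lambda>i. form_ker (M i)) ` lines L)) \<and>
          (\<forall>F\<in>flats L. \<forall>G\<in>flats L. F \<subseteq> G \<longleftrightarrow> \<phi> G \<subseteq> \<phi> F) \<and>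
          (\<forall>i\<in>lines L. \<phi> {i} = form_ker (M i)))}"

definition has_realization :: "'k::field itself \<Rightarrow> 'l matroid3 \<Rightarrow> bool" where
  "has_realization _ L \<longleftrightarrow> (realizations L :: ('l \<Rightarrow> 'k ^ 3) set) \<noteq> {}"


section \<open>The Zariski topology, quotient topologies and Krull dimension\<close>

inductive polynomial_map :: "'l set \<Rightarrow> (('l \<Rightarrow> 'k::field ^ 3) \<Rightarrow> 'k) \<Rightarrow> bool" for E where
  const: "polynomial_map E (\<lambda>M. c)"
| coord: "i \<in> E \<Longrightarrow> polynomial_map E (\<lambda>M. M i $ j)"
| add: "polynomial_map E f \<Longrightarrow> polynomial_map E g \<Longrightarrow> polynomial_map E (\<lambda>M. f M + g M)"
| mult: "polynomial_map E f \<Longrightarrow> polynomial_map E g \<Longrightarrow> polynomial_map E (\<lambda>M. f M * g M)"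

definition zero_locus :: "'l set \<Rightarrow> (('l \<Rightarrow> 'k::field ^ 3) \<Rightarrow> 'k) set \<Rightarrow> ('l \<Rightarrow> 'k ^ 3) set" where
  "zero_locus E F = {M \<in> matrices E. \<forall>f\<in>F. f M = 0}"

definition zariski_topology :: "'l set \<Rightarrow> ('l \<Rightarrow> 'k::field ^ 3) topology" where
  "zariski_topology E = topology (\<lambda>S. S \<subseteq> matrices E \<and>
     (\<exists>F \<subseteq> Collect (polynomial_map E). matrices E - S = zero_locus E F))"

lemma istopology_zariski:
  "istopology (\<lambda>S. S \<subseteq> matrices E \<and>
     (\<exists>F \<subseteq> Collect (polynomial_map E). matrices E - S = zero_locus E (F :: (_ \<Rightarrow> 'k::field) set)))"
  (is "istopology ?P")
  unfolding istopology_def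
proof (intro conjI allI impI)
  fix S T :: "('a \<Rightarrow> 'k ^ 3) set"
  assume "?P S" "?P T"
  then obtain F G where F: "F \<subseteq> Collect (polynomial_map E)" "matrices E - S = zero_locus E F"
    and G: "G \<subseteq> Collect (polynomial_map E)" "matrices E - T = zero_locus E G"
    and "S \<subseteq> matrices E" by blast
  let ?H = "(\<lambda>(f, g) M. f M * g M) ` (F \<times> G)"
  have "?H \<subseteq> Collect (polynomial_map E)"
    using F(1) G(1) by (auto intro: polynomial_map.mult)
  moreover have "zero_locus E ?H = zero_locus E F \<union> zero_locus E G"
  proof
    show "zero_locus E F \<union> zero_locus E G \<subseteq> zero_locus E ?H"
      by (auto simp: zero_locus_def)
    show "zero_locus E ?H \<subseteq> zero_locus E F \<union> zero_locus E G"
    proof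
      fix M assume M: "M \<in> zero_locus E ?H"
      then have prod0: "f M * g M = 0" if "f \<in> F" "g \<in> G" for f g
        using that by (force simp: zero_locus_def)
      from M have "M \<in> matrices E" by (simp add: zero_locus_def)
      then show "M \<in> zero_locus E F \<union> zero_locus E G"
      proof (cases "\<forall>f\<in>F. f M = 0")
        case True
        with \<open>M \<in> matrices E\<close> show ?thesis by (simp add: zero_locus_def)
      next
        case False
        then obtain f where "f \<in> F" "f M \<noteq> 0" by blast
        with prod0 have "\<forall>g\<in>G. g M = 0" by force
        with \<open>M \<in> matrices E\<close> show ?thesis by (simp add: zero_locus_def)
      qed
    qed
  qed
  ultimately have "?H \<subseteq> Collect (polynomial_map E) \<and> matrices E - S \<inter> T = zero_locus E ?H"
    using F(2) G(2) by (simp add: Diff_Int)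
  then show "\<exists>F \<subseteq> Collect (polynomial_map E). matrices E - S \<inter> T = zero_locus E F" by blast
  show "S \<inter> T \<subseteq> matrices E" using \<open>S \<subseteq> matrices E\<close> by blast
next
  fix K :: "('a \<Rightarrow> 'k ^ 3) set set"
  assume K: "\<forall>S\<in>K. ?P S"
  then show "\<Union>K \<subseteq> matrices E" by blast
  from K have "\<forall>S. \<exists>F. S \<in> K \<longrightarrow> F \<subseteq> Collect (polynomial_map E) \<and> matrices E - S = zero_locus E F"
    by blast
  then obtain F where F: "\<And>S. S \<in> K \<Longrightarrow> F S \<subseteq> Collect (polynomial_map E)"
      "\<And>S. S \<in> K \<Longrightarrow> matrices E - S = zero_locus E (F S)"
    by metis
  have "matrices E - \<Union>K = zero_locus E (\<Union>S\<in>K. F S)"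
  proof (rule set_eqI)
    fix M
    have "M \<in> matrices E - \<Union>K \<longleftrightarrow> M \<in> matrices E \<and> (\<forall>S\<in>K. M \<in> matrices E - S)" by blast
    also have "\<dots> \<longleftrightarrow> M \<in> zero_locus E (\<Union>S\<in>K. F S)"
      using F(2) by (auto simp: zero_locus_def)
    finally show "M \<in> matrices E - \<Union>K \<longleftrightarrow> M \<in> zero_locus E (\<Union>S\<in>K. F S)" .
  qed
  moreover have "(\<Union>S\<in>K. F S) \<subseteq> Collect (polynomial_map E)" using F(1) by blast
  ultimately show "\<exists>F \<subseteq> Collect (polynomial_map E). matrices E - \<Union>K = zero_locus E F" by blast
qed

lemma topspace_zariski [simp]: "topspace (zariski_topology E) = matrices E"
proof -
  have "matrices E - matrices E = zero_locus E {\<lambda>M. 1 :: 'b}" by (simp add: zero_locus_def)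
  then have "openin (zariski_topology E) (matrices E :: ('a \<Rightarrow> 'b ^ 3) set)"
    unfolding zariski_topology_def topology_inverse'[OF istopology_zariski]
    by (intro conjI exI[of _ "{\<lambda>M. 1}"]) (auto intro: polynomial_map.const)
  moreover have "topspace (zariski_topology E) \<subseteq> (matrices E :: ('a \<Rightarrow> 'b ^ 3) set)"
    unfolding topspace_def zariski_topology_def topology_inverse'[OF istopology_zariski] by blast
  ultimately show ?thesis using openin_subset by blast
qed

lemma closedin_zariski:
  "closedin (zariski_topology E) Z \<longleftrightarrow> (\<exists>F \<subseteq> Collect (polynomial_map E). Z = zero_locus E F)"
proof -
  have "matrices E - (matrices E - Z) = Z" if "Z \<subseteq> matrices E" using that by blast
  moreover have "zero_locus E F \<subseteq> matrices E" for F :: "(('a \<Rightarrow> 'b ^ 3) \<Rightarrow> 'b) set"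
    by (auto simp: zero_locus_def)
  ultimately show ?thesis
    unfolding closedin_def topspace_zariski
    unfolding zariski_topology_def topology_inverse'[OF istopology_zariski]
    by (metis Diff_subset)
qed

definition quotient_topology :: "'a topology \<Rightarrow> ('a \<Rightarrow> 'b) \<Rightarrow> 'b topology" where
  "quotient_topology X p = topology (\<lambda>S. S \<subseteq> p ` topspace X \<and> openin X {x \<in> topspace X. p x \<in> S})"

lemma openin_quotient_topology:
  "openin (quotient_topology X p) S \<longleftrightarrow>
     S \<subseteq> p ` topspace X \<and> openin X {x \<in> topspace X. p x \<in> S}"
proof -
  have "istopology (\<lambda>S. S \<subseteq> p ` topspace X \<and> openin X {x \<in> topspace X. p x \<in> S})"
    unfolding istopology_def
  proof (intro conjI allI impI)
    fix S T
    assume "S \<subseteq> p ` topspace X \<and> openin X {x \<in> topspace X. p x \<in> S}"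
      and "T \<subseteq> p ` topspace X \<and> openin X {x \<in> topspace X. p x \<in> T}"
    moreover have "{x \<in> topspace X. p x \<in> S \<inter> T} =
        {x \<in> topspace X. p x \<in> S} \<inter> {x \<in> topspace X. p x \<in> T}" by blast
    ultimately show "S \<inter> T \<subseteq> p ` topspace X" "openin X {x \<in> topspace X. p x \<in> S \<inter> T}"
      by auto
  next
    fix K
    assume K: "\<forall>S\<in>K. S \<subseteq> p ` topspace X \<and> openin X {x \<in> topspace X. p x \<in> S}"
    then show "\<Union>K \<subseteq> p ` topspace X" by blast
    have "{x \<in> topspace X. p x \<in> \<Union>K} = (\<Union>S\<in>K. {x \<in> topspace X. p x \<in> S})" by blast
    then show "openin X {x \<in> topspace X. p x \<in> \<Union>K}" using K by auto
  qed
  then show ?thesis by (simp add: quotient_topology_def topology_inverse')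
qed

lemma quotient_map_quotient_topology: "quotient_map X (quotient_topology X p) p"
proof -
  have "{x \<in> topspace X. p x \<in> p ` topspace X} = topspace X" by blast
  then have "openin (quotient_topology X p) (p ` topspace X)"
    by (simp add: openin_quotient_topology)
  then have "topspace (quotient_topology X p) = p ` topspace X"
    by (meson openin_quotient_topology openin_subset openin_topspace subset_antisym)
  then show ?thesis by (simp add: quotient_map_def openin_quotient_topology)
qed

lemma topspace_quotient_topology [simp]: "topspace (quotient_topology X p) = p ` topspace X"
  using quotient_map_quotient_topology[of X p] by (simp add: quotient_map_def)

definition irreducible_closed :: "'a topology \<Rightarrow> 'a set \<Rightarrow> bool" where
  "irreducible_closed X Z \<longleftrightarrow> closedin X Z \<and> Z \<noteq> {} \<and>
     (\<forall>A B. closedin X A \<and> closedin X B \<and> Z \<subseteq> A \<union> B \<longrightarrow> Z \<subseteq> A \<or> Z \<subseteq> B)"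

text \<open>The values are extended reals because the empty space has dimension \<open>-\<infinity>\<close>.\<close>

definition krull_dim :: "'a topology \<Rightarrow> ereal" where
  "krull_dim X = Sup {ereal (real n) | n.
     \<exists>Z :: nat \<Rightarrow> 'a set. (\<forall>i\<le>n. irreducible_closed X (Z i)) \<and> (\<forall>i<n. Z i \<subset> Z (Suc i))}"


section \<open>The moduli space\<close>

definition torus_rel :: "'l matroid3 \<Rightarrow> (('l \<Rightarrow> 'k::field ^ 3) \<times> ('l \<Rightarrow> 'k ^ 3)) set" where
  "torus_rel L = {(M, N). M \<in> realizations L \<and> N \<in> realizations L \<and>
     (\<exists>c. (\<forall>i\<in>lines L. c i \<noteq> 0) \<and> N = (\<lambda>i\<in>lines L. c i *s M i))}"

text \<open>Elements of \<open>PGL(3, K)\<close> are represented by invertible matrices; scalar matrices fix every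
  torus orbit.\<close>

definition pgl_rel :: "'l matroid3 \<Rightarrow> (('l \<Rightarrow> 'k::field ^ 3) set \<times> ('l \<Rightarrow> 'k ^ 3) set) set" where
  "pgl_rel L = {(X, Y). X \<in> realizations L // torus_rel L \<and> Y \<in> realizations L // torus_rel L \<and>
     (\<exists>A :: 'k ^ 3 ^ 3. invertible A \<and> Y = (\<lambda>M. \<lambda>i\<in>lines L. A *v M i) ` X)}"

definition moduli_space :: "'l matroid3 \<Rightarrow> ('l \<Rightarrow> 'k::field ^ 3) set set set" where
  "moduli_space L = (realizations L // torus_rel L) // pgl_rel L"

definition moduli_topology :: "'l matroid3 \<Rightarrow> ('l \<Rightarrow> 'k::field ^ 3) set set topology" where
  "moduli_topology L =
     quotient_topology
       (quotient_topology (subtopology (zariski_topology (lines L)) (realizations L))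
          (\<lambda>M. torus_rel L `` {M}))
       (\<lambda>X. pgl_rel L `` {X})"

lemma topspace_moduli_topology: "topspace (moduli_topology L) = moduli_space L"
proof -
  have "matrices (lines L) \<inter> realizations L = realizations L"
    by (auto simp: realizations_def)
  then show ?thesis
    by (auto simp: moduli_topology_def moduli_space_def quotient_def)
qed

definition moduli_dim :: "'k::field itself \<Rightarrow> 'l matroid3 \<Rightarrow> ereal" where
  "moduli_dim _ L = krull_dim (moduli_topology L :: ('l \<Rightarrow> 'k ^ 3) set set topology)"


section \<open>The matroid with 16 lines and 38 points\<close>

text \<open>The \<open>i\<close>-th entry, counted from one, lists the labels of the points on line \<open>i\<close>.\<close>

definition point_labels :: "nat list list" where
  "point_labels =
    [[1,29,30,31,32,33,34,35,36,37,38],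
     [2,5,12,15,26,28,35],
     [2,11,21,22,23,25,36],
     [3,4,5,6,9,23,33],
     [3,7,10,11,16,26,30],
     [2,6,13,16,17,24,38],
     [2,8,9,10,18,19,31],
     [2,4,7,14,20,27,37],
     [3,12,19,20,21,24,29],
     [3,8,13,14,15,22,34],
     [3,17,18,25,27,28,32],
     [1,6,8,21,26,27],
     [1,5,10,17,20,22],
     [1,7,12,13,18,23],
     [1,4,15,16,19,25],
     [1,9,11,14,24,28]]"

definition labelled_point :: "nat \<Rightarrow> nat set" where
  "labelled_point k = {i \<in> {1..16}. k \<in> set (point_labels ! (i - 1))}"

definition matroid_16_38 :: "nat matroid3" where
  "matroid_16_38 = \<lparr>lines = {1..16}, points = labelled_point ` {1..38}\<rparr>"

lemma point_labels_nth:
  "point_labels ! 0 = [1,29,30,31,32,33,34,35,36,37,38]"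
  "point_labels ! Suc 0 = [2,5,12,15,26,28,35]"
  "point_labels ! 2 = [2,11,21,22,23,25,36]"
  "point_labels ! 3 = [3,4,5,6,9,23,33]"
  "point_labels ! 4 = [3,7,10,11,16,26,30]"
  "point_labels ! 5 = [2,6,13,16,17,24,38]"
  "point_labels ! 6 = [2,8,9,10,18,19,31]"
  "point_labels ! 7 = [2,4,7,14,20,27,37]"
  "point_labels ! 8 = [3,12,19,20,21,24,29]"
  "point_labels ! 9 = [3,8,13,14,15,22,34]"
  "point_labels ! 10 = [3,17,18,25,27,28,32]"
  "point_labels ! 11 = [1,6,8,21,26,27]"
  "point_labels ! 12 = [1,5,10,17,20,22]"
  "point_labels ! 13 = [1,7,12,13,18,23]"
  "point_labels ! 14 = [1,4,15,16,19,25]"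
  "point_labels ! 15 = [1,9,11,14,24,28]"
  by (simp_all add: point_labels_def)

lemma common_label:
  assumes "a \<in> {1..16}" "b \<in> {1..16}" "a \<noteq> b"
  shows "\<exists>k\<in>{1..38}. filter (\<lambda>k. k \<in> set (point_labels ! (b - 1))) (point_labels ! (a - 1)) = [k]"
proof -
  let ?xs = "point_labels ! (a - 1)" and ?ys = "point_labels ! (b - 1)"
  have all: "list_all (\<lambda>xs. list_all (\<lambda>ys. xs = ys \<or>
      length (filter (\<lambda>k. k \<in> set ys) xs) = 1) point_labels) point_labels"
    by (simp add: point_labels_def)
  have bound: "list_all (\<lambda>xs. list_all (\<lambda>k. 1 \<le> k \<and> k \<le> 38) xs) point_labels"
    by (simp add: point_labels_def)
  have len: "length point_labels = 16" and dist: "distinct point_labels"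
    by (simp_all add: point_labels_def)
  have ab: "a - 1 < 16" "b - 1 < 16" "a - 1 \<noteq> b - 1" using assms by auto
  then have mem: "?xs \<in> set point_labels" "?ys \<in> set point_labels" using len by simp_all
  have "?xs \<noteq> ?ys" using ab len dist by (simp add: nth_eq_iff_index_eq)
  then have "length (filter (\<lambda>k. k \<in> set ?ys) ?xs) = 1"
    using all mem unfolding list_all_iff by blast
  then obtain k where k: "filter (\<lambda>k. k \<in> set ?ys) ?xs = [k]"
    by (metis One_nat_def length_0_conv length_Suc_conv)
  then have "k \<in> set (filter (\<lambda>k. k \<in> set ?ys) ?xs)" by (simp only: list.set insert_iff simp_thms)
  then have "k \<in> set ?xs" by simp
  with bound mem have "k \<in> {1..38}" unfolding list_all_iff by simp
  with k show ?thesis by blast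
qed

lemma ex1_common_label:
  assumes "a \<in> {1..16}" "b \<in> {1..16}" "a \<noteq> b"
  shows "\<exists>!k. k \<in> {1..38} \<and> a \<in> labelled_point k \<and> b \<in> labelled_point k"
proof -
  obtain k where k: "k \<in> {1..38}"
    "filter (\<lambda>k. k \<in> set (point_labels ! (b - 1))) (point_labels ! (a - 1)) = [k]"
    using common_label[OF assms] by blast
  have "a \<in> labelled_point l \<and> b \<in> labelled_point l \<longleftrightarrow> l = k" for l
  proof -
    have "l \<in> set (filter (\<lambda>k. k \<in> set (point_labels ! (b - 1))) (point_labels ! (a - 1))) \<longleftrightarrow> l = k"
      unfolding k(2) by simp
    then show ?thesis using assms by (auto simp: labelled_point_def)
  qed
  then show ?thesis using k(1) by auto
qed

lemma labelled_point_bounds: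
  assumes "k \<in> {1..38}"
  shows "2 \<le> card (labelled_point k) \<and> labelled_point k \<subset> {1..16}"
proof -
  define W :: "(nat \<times> nat \<times> nat) list" where "W =
     [(1,1,12),(2,2,3),(3,4,5),(4,4,8),(5,2,4),(6,4,6),(7,5,8),(8,7,10),
      (9,4,7),(10,5,7),(11,3,5),(12,2,9),(13,6,10),(14,8,10),(15,2,10),(16,5,6),
      (17,6,11),(18,7,11),(19,7,9),(20,8,9),(21,3,9),(22,3,10),(23,3,4),(24,6,9),
      (25,3,11),(26,2,5),(27,8,11),(28,2,11),(29,1,9),(30,1,5),(31,1,7),(32,1,11),
      (33,1,4),(34,1,10),(35,1,2),(36,1,3),(37,1,8),(38,1,6)]"
  have "list_all (\<lambda>(k, a, b). a \<in> {1..16} \<and> b \<in> {1..16} \<and> a \<noteq> b \<and>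
      k \<in> set (point_labels ! (a - 1)) \<and> k \<in> set (point_labels ! (b - 1))) W"
    unfolding W_def by (simp add: point_labels_nth)
  moreover have "map fst W = [1..<39]" unfolding W_def by (simp add: upt_rec)
  then have "set (map fst W) = {1..38}" by auto
  then have "k \<in> fst ` set W" using assms by simp
  ultimately obtain a b where "a \<noteq> b" "{a, b} \<subseteq> labelled_point k"
    by (force simp: list_all_iff labelled_point_def)
  moreover have "finite (labelled_point k)" by (simp add: labelled_point_def)
  ultimately have "2 \<le> card (labelled_point k)" by (metis card_2_iff card_mono)
  moreover have "\<not> {1, 2, 3} \<subseteq> labelled_point k"
    by (auto simp: labelled_point_def point_labels_nth)
  moreover have "{1, 2, 3} \<subseteq> {1..16::nat}" by simp
  ultimately have "2 \<le> card (labelled_point k) \<and> labelled_point k \<noteq> {1..16}" by metis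
  moreover have "labelled_point k \<subseteq> {1..16}" by (auto simp: labelled_point_def)
  ultimately show ?thesis by auto
qed

lemma inj_labelled_point: "inj_on labelled_point {1..38}"
proof (rule inj_onI)
  fix k l assume kl: "k \<in> {1..38}" "l \<in> {1..38}" "labelled_point k = labelled_point l"
  have "2 \<le> card (labelled_point k)" "labelled_point k \<subseteq> {1..16}"
    using labelled_point_bounds[OF kl(1)] by auto
  then obtain a b where "a \<in> labelled_point k" "b \<in> labelled_point k" "a \<noteq> b"
    by (auto simp: card_le_Suc_iff numeral_2_eq_2)
  then show "k = l"
    using ex1_common_label[of a b] kl \<open>labelled_point k \<subseteq> {1..16}\<close> by (metis subsetD)
qed

lemma card_points_matroid_16_38: "card (points matroid_16_38) = 38"
  using card_image[OF inj_labelled_point] by (simp add: matroid_16_38_def)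

lemma rank_three_matroid_16_38: "rank_three_matroid matroid_16_38"
proof -
  have "\<exists>!v. v \<in> labelled_point ` {1..38} \<and> a \<in> v \<and> b \<in> v"
    if ab: "a \<in> {1..16}" "b \<in> {1..16}" "a \<noteq> b" for a b
  proof -
    obtain k where k: "k \<in> {1..38}" "a \<in> labelled_point k" "b \<in> labelled_point k"
      and unique: "\<And>l. l \<in> {1..38} \<Longrightarrow> a \<in> labelled_point l \<Longrightarrow> b \<in> labelled_point l \<Longrightarrow> l = k"
      using ex1_common_label[OF ab] by (elim ex1E) blast
    show ?thesis
    proof (rule ex1I)
      show "labelled_point k \<in> labelled_point ` {1..38} \<and> a \<in> labelled_point k \<and> b \<in> labelled_point k"
        using k by simp
    next
      fix v assume v: "v \<in> labelled_point ` {1..38} \<and> a \<in> v \<and> b \<in> v"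
      then obtain l where "l \<in> {1..38}" "v = labelled_point l" by blast
      with v unique[of l] show "v = labelled_point k" by simp
    qed
  qed
  moreover have "v \<subset> {1..16} \<and> 2 \<le> card v" if "v \<in> labelled_point ` {1..38}" for v
    using that labelled_point_bounds by blast
  ultimately show ?thesis
    unfolding rank_three_matroid_def matroid_16_38_def matroid3.simps
    by (intro conjI ballI impI) simp_all
qed

end

theory Submission
  imports Defs
begin

text \<open>
  Leave out line 1, which passes through one point of higher multiplicity and otherwise only through
  double points. The other fifteen lines form a 3-net of order five, realizing the addition table of
  the integers modulo five, and each of its three classes is a pencil. In characteristic zero such a
  net is projectively unique up to the choice of a primitive fifth root of unity \<open>\<zeta>\<close>: in suitable
  coordinates its lines are \<open>x = \<zeta>^i z\<close>, \<open>y = \<zeta>^j z\<close> and \<open>y = \<zeta>^k x\<close> (lemma \<open>normal_form_exists\<close>, resting on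
  \<open>affine_five_cycle\<close>). Line 1 becomes \<open>y = t x\<close>, and every \<open>t\<close> with \<open>t \<noteq> 0\<close> and \<open>t^5 \<noteq> 1\<close> is possible
  (lemma \<open>represents_normal_form\<close>).

  A realization over the reals would give a real root of \<open>1 + x + x^2 + x^3 + x^4\<close>, which is positive.
  Over the complex numbers the moduli space consists of four copies of a punctured line, one for each
  \<open>\<zeta>\<close>. Both \<open>\<zeta>\<close> and \<open>t\<close> are cross-ratios of the realization, so the copies and the points are closed,
  and the closed subsets of a copy are the zero sets of polynomials in \<open>t\<close>; this gives dimension one
  (lemmas \<open>closedin_level_sets_of_invariants\<close> and \<open>krull_dim_finite_union_cofinite\<close>). To work with matrices
  rather than lattice isomorphisms, realizations are first characterized by the vanishing of
  determinants (lemma \<open>realizations_iff\<close>).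

  For the generation number, five lines suffice by an explicit construction in the net. Four lines
  never suffice: line 1 must be one of them, and then at most one line is added
  (lemma \<open>four_generators_insufficient\<close>).
\<close>

section \<open>Linear forms on a three-dimensional space\<close>

definition bracket :: "'k::field ^ 3 \<Rightarrow> 'k ^ 3 \<Rightarrow> 'k ^ 3 \<Rightarrow> 'k" where
  "bracket a b c =
     a $ 1 * (b $ 2 * c $ 3 - b $ 3 * c $ 2) - a $ 2 * (b $ 1 * c $ 3 - b $ 3 * c $ 1) +
     a $ 3 * (b $ 1 * c $ 2 - b $ 2 * c $ 1)"

text \<open>The vector product over an arbitrary field: for independent forms \<open>a\<close> and \<open>b\<close> it spans
  the intersection of their kernels.\<close>

definition meet :: "'k::field ^ 3 \<Rightarrow> 'k ^ 3 \<Rightarrow> 'k ^ 3" where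
  "meet a b = vector [a $ 2 * b $ 3 - a $ 3 * b $ 2, a $ 3 * b $ 1 - a $ 1 * b $ 3,
     a $ 1 * b $ 2 - a $ 2 * b $ 1]"

lemma scalar_product_3:
  "scalar_product (v :: 'k::field ^ 3) w = v $ 1 * w $ 1 + v $ 2 * w $ 2 + v $ 3 * w $ 3"
  by (simp add: scalar_product_def sum_3)

lemma scalar_product_meet: "scalar_product a (meet b c) = bracket a b c"
  by (simp add: scalar_product_3 meet_def bracket_def algebra_simps)

lemma bracket_repeat [simp]: "bracket a a b = 0" "bracket a b a = 0" "bracket a b b = 0"
  by (simp_all add: bracket_def algebra_simps)

lemma bracket_rotate: "bracket b c a = bracket a b c"
  by (simp add: bracket_def algebra_simps)

lemma bracket_swap: "bracket b a c = - bracket a b c"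
  by (simp add: bracket_def algebra_simps)

lemma bracket_mult: "bracket (A *v a) (A *v b) (A *v c) = det A * bracket a b c"
  by (simp add: bracket_def matrix_vector_mult_def det_3 sum_3 algebra_simps)

lemma bracket_scale: "bracket (x *s a) (y *s b) (z *s c) = x * y * z * bracket a b c"
  by (simp add: bracket_def algebra_simps)

lemma bracket_eq_0_if_common_zero:
  assumes "x \<noteq> 0" and zero: "scalar_product a x = 0" "scalar_product b x = 0" "scalar_product c x = 0"
  shows "bracket a b c = 0"
proof -
  have "bracket a b c * x $ 1 =
      scalar_product a x * (b $ 2 * c $ 3 - b $ 3 * c $ 2) -
      scalar_product b x * (a $ 2 * c $ 3 - a $ 3 * c $ 2) +
      scalar_product c x * (a $ 2 * b $ 3 - a $ 3 * b $ 2)"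
    "bracket a b c * x $ 2 =
      - scalar_product a x * (b $ 1 * c $ 3 - b $ 3 * c $ 1) +
      scalar_product b x * (a $ 1 * c $ 3 - a $ 3 * c $ 1) -
      scalar_product c x * (a $ 1 * b $ 3 - a $ 3 * b $ 1)"
    "bracket a b c * x $ 3 =
      scalar_product a x * (b $ 1 * c $ 2 - b $ 2 * c $ 1) -
      scalar_product b x * (a $ 1 * c $ 2 - a $ 2 * c $ 1) +
      scalar_product c x * (a $ 1 * b $ 2 - a $ 2 * b $ 1)"
    by (simp_all add: bracket_def scalar_product_3 algebra_simps)
  then have "bracket a b c * x $ i = 0" for i
    using zero exhaust_3[of i] by auto
  then show ?thesis using \<open>x \<noteq> 0\<close> by (auto simp: vec_eq_iff)
qed

lemma common_zero_if_bracket_eq_0: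
  assumes "meet a b \<noteq> 0" and "bracket c a b = 0"
    and "scalar_product a x = 0" "scalar_product b x = 0"
  shows "scalar_product c x = 0"
proof -
  let ?n = "meet a b"
  \<comment> \<open>The vector product of \<open>x\<close> with \<open>meet a b\<close> vanishes, so \<open>x\<close> is proportional to \<open>meet a b\<close>.\<close>
  have "x $ 2 * ?n $ 3 - x $ 3 * ?n $ 2 = a $ 1 * scalar_product b x - b $ 1 * scalar_product a x"
    "x $ 3 * ?n $ 1 - x $ 1 * ?n $ 3 = a $ 2 * scalar_product b x - b $ 2 * scalar_product a x"
    "x $ 1 * ?n $ 2 - x $ 2 * ?n $ 1 = a $ 3 * scalar_product b x - b $ 3 * scalar_product a x"
    by (simp_all add: meet_def scalar_product_3 algebra_simps)
  then have "x $ 2 * ?n $ 3 = x $ 3 * ?n $ 2" "x $ 3 * ?n $ 1 = x $ 1 * ?n $ 3"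
    "x $ 1 * ?n $ 2 = x $ 2 * ?n $ 1"
    using assms(3,4) by simp_all
  then have "scalar_product c x * ?n $ j = scalar_product c ?n * x $ j" for j
    using exhaust_3[of j] by (auto simp: scalar_product_3 algebra_simps)
  then have "scalar_product c x * ?n $ j = 0" for j
    using assms(2) by (simp add: scalar_product_meet)
  then show ?thesis using assms(1) by (auto simp: vec_eq_iff)
qed

lemma form_ker_scale: "c \<noteq> 0 \<Longrightarrow> form_ker (c *s a) = form_ker (a :: 'k::field ^ 3)"
  by (auto simp: form_ker_def scalar_product_3 mult.assoc simp flip: distrib_left)

lemma proportional_if_meet_eq_0:
  assumes "a \<noteq> 0" "b \<noteq> 0" "meet a b = 0"
  obtains c where "c \<noteq> 0" "b = c *s a"
proof -
  obtain i where i: "a $ i \<noteq> 0" using assms(1) by (auto simp: vec_eq_iff)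
  have "meet a b $ 1 = 0" "meet a b $ 2 = 0" "meet a b $ 3 = 0" using assms(3) by simp_all
  then have "a $ 2 * b $ 3 = a $ 3 * b $ 2" "a $ 3 * b $ 1 = a $ 1 * b $ 3"
    "a $ 1 * b $ 2 = a $ 2 * b $ 1" by (simp_all add: meet_def)
  then have "a $ i * b $ j = b $ i * a $ j" for j
    using exhaust_3[of i] exhaust_3[of j] by (auto simp: mult.commute)
  then have eq: "b = (b $ i / a $ i) *s a" using i by (simp add: vec_eq_iff field_simps)
  moreover have "b $ i / a $ i \<noteq> 0"
    using eq \<open>b \<noteq> 0\<close> by (metis vector_smult_lzero)
  ultimately show ?thesis using that by blast
qed

lemma coordinates_wrt_basis:
  fixes f1 f2 f3 :: "'k::field ^ 3"
  assumes "bracket f1 f2 f3 \<noteq> 0"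
  obtains G :: "'k ^ 3 ^ 3" where "invertible G"
    "\<And>x y z. G *v (x *s f1 + y *s f2 + z *s f3) = vector [x, y, z]"
proof -
  define F :: "'k ^ 3 ^ 3" where "F = transpose (vector [f1, f2, f3])"
  have "det F = bracket f1 f2 f3"
    unfolding F_def det_transpose by (simp add: det_3 bracket_def algebra_simps)
  then have "invertible F" using assms by (simp add: invertible_det_nz)
  then obtain G where G: "F ** G = mat 1" "G ** F = mat 1" by (auto simp: invertible_def)
  have "F *v vector [x, y, z] = x *s f1 + y *s f2 + z *s f3" for x y z
    by (simp add: F_def vec_eq_iff matrix_vector_mult_def transpose_def sum_3 algebra_simps)
  then have "G *v (x *s f1 + y *s f2 + z *s f3) = vector [x, y, z]" for x y z
    by (metis G(2) matrix_vector_mul_assoc matrix_vector_mul_lid)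
  moreover have "invertible G" using G by (auto simp: invertible_def)
  ultimately show ?thesis using that by blast
qed

section \<open>Realizations as solutions of determinantal conditions\<close>

lemma points_eq:
  assumes "rank_three_matroid L" "v \<in> points L" "w \<in> points L" "a \<in> v" "b \<in> v" "a \<in> w" "b \<in> w" "a \<noteq> b"
  shows "v = w"
proof -
  have "a \<in> lines L" "b \<in> lines L" using assms by (auto simp: rank_three_matroid_def)
  then have "\<exists>!v. v \<in> points L \<and> a \<in> v \<and> b \<in> v"
    using assms(1,8) by (simp add: rank_three_matroid_def)
  then show ?thesis using assms(2-7) by blast
qed

definition concurrent :: "'l matroid3 \<Rightarrow> 'l \<Rightarrow> 'l \<Rightarrow> 'l \<Rightarrow> bool" where
  "concurrent L i j k \<longleftrightarrow> (\<exists>v\<in>points L. i \<in> v \<and> j \<in> v \<and> k \<in> v)"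

lemma concurrent_iff:
  assumes "rank_three_matroid L" "v \<in> points L" "i \<in> v" "j \<in> v" "i \<noteq> j"
  shows "concurrent L i j k \<longleftrightarrow> k \<in> v"
  unfolding concurrent_def using points_eq[OF assms(1,2)] assms(2-5) by blast

text \<open>The lattice condition in terms of determinants. It makes the forms of any two lines independent,
  since some third line misses their common point.\<close>

definition represents :: "'l matroid3 \<Rightarrow> ('l \<Rightarrow> 'k::field ^ 3) \<Rightarrow> bool" where
  "represents L M \<longleftrightarrow> (\<forall>i\<in>lines L. \<forall>j\<in>lines L. \<forall>k\<in>lines L. i \<noteq> j \<and> i \<noteq> k \<and> j \<noteq> k \<longrightarrow>
     (bracket (M i) (M j) (M k) = 0 \<longleftrightarrow> concurrent L i j k))"

lemma representsD:
  assumes "represents L M" "i \<in> lines L" "j \<in> lines L" "k \<in> lines L" "i \<noteq> j" "i \<noteq> k" "j \<noteq> k"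
  shows "bracket (M i) (M j) (M k) = 0 \<longleftrightarrow> concurrent L i j k"
  using assms by (simp add: represents_def)

lemma point_through:
  assumes "rank_three_matroid L" "i \<in> lines L" "j \<in> lines L" "i \<noteq> j"
  obtains v where "v \<in> points L" "i \<in> v" "j \<in> v" "v \<subset> lines L"
  using assms unfolding rank_three_matroid_def by metis

text \<open>A rank-two flat is sent to an element of the intersection lattice strictly above its least
  element, hence to one with a nonzero vector; this is a common zero of the three forms. Conversely a
  dependent form vanishes on the intersection of the other two kernels, and the flat that corresponds
  to this intersection is contained in their point.\<close>

lemma represents_if_realization:
  assumes L: "rank_three_matroid L" and M: "M \<in> realizations L"
  shows "represents L M"
  unfolding represents_def
proof (intro ballI impI)
  fix i j k assume ijk: "i \<in> lines L" "j \<in> lines L" "k \<in> lines L" "i \<noteq> j \<and> i \<noteq> k \<and> j \<noteq> k"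
  let ?ker = "\<lambda>i. form_ker (M i)"
  obtain \<phi> where \<phi>: "bij_betw \<phi> (flats L) (intersection_lattice (?ker ` lines L))"
    and order: "\<And>F G. F \<in> flats L \<Longrightarrow> G \<in> flats L \<Longrightarrow> F \<subseteq> G \<longleftrightarrow> \<phi> G \<subseteq> \<phi> F"
    and \<phi>_line: "\<And>i. i \<in> lines L \<Longrightarrow> \<phi> {i} = ?ker i"
    using M unfolding realizations_def by auto
  have nz: "M i \<noteq> 0" if "i \<in> lines L" for i using M that by (simp add: realizations_def)
  have inj: "inj_on ?ker (lines L)" using M by (simp add: realizations_def)
  have flat: "{} \<in> flats L" "lines L \<in> flats L" "\<And>i. i \<in> lines L \<Longrightarrow> {i} \<in> flats L"
    "\<And>v. v \<in> points L \<Longrightarrow> v \<in> flats L" by (auto simp: flats_def)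
  have \<phi>_in: "\<phi> F \<in> intersection_lattice (?ker ` lines L)" if "F \<in> flats L" for F
    using \<phi> that by (auto simp: bij_betw_def)
  have zero_in: "0 \<in> X" if "X \<in> intersection_lattice (?ker ` lines L)" for X
    using that by (auto simp: intersection_lattice_def form_ker_def scalar_product_3)
  have point_sub: "\<phi> v \<subseteq> ?ker i" if "v \<in> points L" "i \<in> v" for v i
  proof -
    have "i \<in> lines L" using L that by (auto simp: rank_three_matroid_def)
    then show ?thesis using order[of "{i}" v] flat that \<phi>_line by auto
  qed
  have "concurrent L i j k" if 0: "bracket (M i) (M j) (M k) = 0"
  proof -
    have "meet (M i) (M j) \<noteq> 0"
    proof
      assume "meet (M i) (M j) = 0"
      then obtain c where "c \<noteq> 0" "M j = c *s M i"
        using proportional_if_meet_eq_0 nz ijk by metis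
      then have "?ker j = ?ker i" by (simp add: form_ker_scale)
      then show False using inj ijk by (auto dest: inj_onD)
    qed
    moreover have "bracket (M k) (M i) (M j) = 0" using 0 by (simp add: bracket_rotate)
    ultimately have sub: "?ker i \<inter> ?ker j \<subseteq> ?ker k"
      unfolding form_ker_def using common_zero_if_bracket_eq_0 by blast
    have "?ker i \<inter> ?ker j \<in> intersection_lattice (?ker ` lines L)"
      unfolding intersection_lattice_def using ijk by (intro CollectI exI[of _ "{?ker i, ?ker j}"]) auto
    then obtain F where F: "F \<in> flats L" "\<phi> F = ?ker i \<inter> ?ker j"
      using \<phi> unfolding bij_betw_def by (metis imageE)
    obtain v where v: "v \<in> points L" "i \<in> v" "j \<in> v"
      using point_through[OF L] ijk by metis
    have "F \<subseteq> v" using order[of F v] F v point_sub flat by auto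
    moreover have "{i} \<subseteq> F" "{j} \<subseteq> F" "{k} \<subseteq> F"
      using order[of "{i}" F] order[of "{j}" F] order[of "{k}" F] F \<phi>_line ijk flat sub by auto
    ultimately show ?thesis using v by (auto simp: concurrent_def)
  qed
  moreover have "bracket (M i) (M j) (M k) = 0" if ccr: "concurrent L i j k"
  proof -
    obtain v where v: "v \<in> points L" "i \<in> v" "j \<in> v" "k \<in> v"
      using ccr by (auto simp: concurrent_def)
    have "v \<subset> lines L" using L v by (auto simp: rank_three_matroid_def)
    then have "\<not> \<phi> v \<subseteq> \<phi> (lines L)" using order[of "lines L" v] flat v by auto
    then obtain x where "x \<in> \<phi> v" "x \<noteq> 0" using zero_in \<phi>_in flat by fastforce
    then show ?thesis
      using point_sub[OF v(1)] v by (intro bracket_eq_0_if_common_zero[of x]) (auto simp: form_ker_def)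
  qed
  ultimately show "bracket (M i) (M j) (M k) = 0 \<longleftrightarrow> concurrent L i j k" by blast
qed

text \<open>The isomorphism sends a flat to the intersection of the kernels of its lines.\<close>

lemma realization_if_represents:
  assumes L: "rank_three_matroid L" and "M \<in> matrices (lines L)" and M: "represents L M"
  shows "M \<in> realizations L"
proof -
  let ?ker = "\<lambda>i. form_ker (M i)"
  have third: "\<exists>k\<in>lines L. k \<noteq> i \<and> k \<noteq> j \<and> bracket (M i) (M j) (M k) \<noteq> 0"
    if ij: "i \<in> lines L" "j \<in> lines L" "i \<noteq> j" for i j
  proof -
    obtain v where v: "v \<in> points L" "i \<in> v" "j \<in> v" "v \<subset> lines L"
      using point_through[OF L ij] by metis
    then obtain k where k: "k \<in> lines L" "k \<notin> v" by auto
    then have "\<not> concurrent L i j k" "k \<noteq> i" "k \<noteq> j" using concurrent_iff[OF L] v ij by auto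
    then show ?thesis using representsD[OF M, of i j k] ij k by auto
  qed
  have two: "\<exists>j\<in>lines L. j \<noteq> i" if "i \<in> lines L" for i
  proof (rule ccontr)
    assume "\<not> ?thesis"
    then have "lines L \<subseteq> {i}" by blast
    then have "card (lines L) \<le> 1" using card_mono[of "{i}" "lines L"] by simp
    then show False using L by (simp add: rank_three_matroid_def)
  qed
  \<comment> \<open>A flat can be recovered from its intersection space; this yields the order embedding below.\<close>
  have closed: "i \<in> G" if G: "G \<in> flats L" and i: "i \<in> lines L"
    and sub: "(\<Inter>j\<in>G. ?ker j) \<subseteq> ?ker i" for G i
  proof (rule ccontr)
    assume "i \<notin> G"
    have "\<exists>x\<in>(\<Inter>j\<in>G. ?ker j). x \<notin> ?ker i"
    proof -
      consider "G = {}" | j where "j \<in> lines L" "G = {j}" | "G \<in> points L"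
        using G \<open>i \<notin> G\<close> i by (auto simp: flats_def)
      then show ?thesis
      proof cases
        case 1
        obtain j where j: "j \<in> lines L" "j \<noteq> i" using two i by auto
        obtain k where "bracket (M i) (M j) (M k) \<noteq> 0" using third[of i j] i j by auto
        then show ?thesis using 1
          by (auto simp: form_ker_def scalar_product_meet intro!: exI[of _ "meet (M j) (M k)"])
      next
        case 2
        then have "i \<noteq> j" using \<open>i \<notin> G\<close> by auto
        then obtain k where "bracket (M i) (M j) (M k) \<noteq> 0" using third[of i j] i 2 by auto
        then show ?thesis using 2
          by (auto simp: form_ker_def scalar_product_meet intro!: exI[of _ "meet (M j) (M k)"])
      next
        case 3
        then have "2 \<le> card G" "G \<subset> lines L" using L by (auto simp: rank_three_matroid_def)
        then obtain j k where jk: "j \<in> G" "k \<in> G" "j \<noteq> k"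
          by (meson card_2_iff' obtain_subset_with_card_n subsetD)
        have "\<not> concurrent L j k i" using concurrent_iff[OF L 3 jk] \<open>i \<notin> G\<close> by simp
        then have "bracket (M j) (M k) (M i) \<noteq> 0"
          using representsD[OF M, of j k i] i jk \<open>i \<notin> G\<close> \<open>G \<subset> lines L\<close> by auto
        then have "meet (M j) (M k) \<notin> ?ker i"
          by (simp add: form_ker_def scalar_product_meet bracket_rotate)
        moreover have "meet (M j) (M k) \<in> ?ker l" if l: "l \<in> G" for l
        proof -
          have "concurrent L l j k" using 3 jk l by (auto simp: concurrent_def)
          then have "l = j \<or> l = k \<or> bracket (M l) (M j) (M k) = 0"
            using representsD[OF M, of l j k] l jk \<open>G \<subset> lines L\<close> by auto
          then show ?thesis by (auto simp: form_ker_def scalar_product_meet)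
        qed
        ultimately show ?thesis by auto
      qed
    qed
    then show False using sub by blast
  qed
  have nz: "M i \<noteq> 0" if "i \<in> lines L" for i
  proof
    assume "M i = 0"
    then have "?ker i = UNIV" by (auto simp: form_ker_def scalar_product_3)
    then show False using closed[of "{}" i] that by (auto simp: flats_def)
  qed
  have inj: "inj_on ?ker (lines L)"
  proof (rule inj_onI)
    fix i j assume "i \<in> lines L" "j \<in> lines L" "?ker i = ?ker j"
    then show "i = j" using closed[of "{j}" i] by (auto simp: flats_def)
  qed
  define \<phi> where "\<phi> G = (\<Inter>j\<in>G. ?ker j)" for G
  have sub_lines: "G \<subseteq> lines L" if "G \<in> flats L" for G
    using that L by (auto simp: flats_def rank_three_matroid_def)
  have order: "F \<subseteq> G \<longleftrightarrow> \<phi> G \<subseteq> \<phi> F" if "F \<in> flats L" "G \<in> flats L" for F G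
  proof
    assume "\<phi> G \<subseteq> \<phi> F"
    show "F \<subseteq> G"
    proof
      fix i assume "i \<in> F"
      moreover from this have "\<phi> G \<subseteq> ?ker i" using \<open>\<phi> G \<subseteq> \<phi> F\<close> by (auto simp: \<phi>_def)
      ultimately show "i \<in> G" using closed[of G i] sub_lines that by (auto simp: \<phi>_def)
    qed
  qed (auto simp: \<phi>_def)
  have "inj_on \<phi> (flats L)" 
  proof (rule inj_onI)
    fix F G assume "F \<in> flats L" "G \<in> flats L" "\<phi> F = \<phi> G"
    then have "F \<subseteq> G" "G \<subseteq> F" using order[of F G] order[of G F] by simp_all
    then show "F = G" by simp
  qed
  moreover have "\<phi> ` flats L = intersection_lattice (?ker ` lines L)"
  proof
    show "\<phi> ` flats L \<subseteq> intersection_lattice (?ker ` lines L)"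
    proof
      fix X assume "X \<in> \<phi> ` flats L"
      then obtain G where G: "G \<in> flats L" "X = \<phi> G" by auto
      then show "X \<in> intersection_lattice (?ker ` lines L)"
        using sub_lines[OF G(1)] unfolding intersection_lattice_def \<phi>_def
        by (intro CollectI exI[of _ "?ker ` G"] conjI image_mono)
    qed
    show "intersection_lattice (?ker ` lines L) \<subseteq> \<phi> ` flats L"
    proof
      fix X assume "X \<in> intersection_lattice (?ker ` lines L)"
      then obtain S where S: "S \<subseteq> lines L" "X = \<phi> S"
        unfolding intersection_lattice_def \<phi>_def by (auto simp: subset_image_iff)
      show "X \<in> \<phi> ` flats L"
      proof (cases "S \<in> flats L")
        case False
        then have "S \<noteq> {}" "\<And>i. S \<noteq> {i}" using S by (auto simp: flats_def)
        then obtain i j where ij: "i \<in> S" "j \<in> S" "i \<noteq> j" by blast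
        then obtain v where v: "v \<in> points L" "i \<in> v" "j \<in> v" "v \<subset> lines L"
          using point_through[OF L] S by (metis subsetD)
        \<comment> \<open>Two independent forms \<open>i\<close> and \<open>j\<close> determine the kernel of every form through their point;
          a form outside this point cuts the intersection down to the origin.\<close>
        have meet_nz: "meet (M i) (M j) \<noteq> 0"
        proof
          assume *: "meet (M i) (M j) = 0"
          obtain k where "bracket (M i) (M j) (M k) \<noteq> 0" using third[of i j] ij S by auto
          then have "scalar_product (M k) (meet (M i) (M j)) \<noteq> 0"
            by (simp add: scalar_product_meet bracket_rotate)
          then show False using * by (simp add: scalar_product_3)
        qed
        have le: "?ker i \<inter> ?ker j \<subseteq> \<phi> v"
        proof -
          have "?ker i \<inter> ?ker j \<subseteq> ?ker l" if "l \<in> v" for l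
          proof (cases "l = i \<or> l = j")
            case False
            then have "bracket (M l) (M i) (M j) = 0"
              using representsD[OF M, of l i j] that v ij by (auto simp: concurrent_def)
            then show ?thesis
              using common_zero_if_bracket_eq_0 meet_nz unfolding form_ker_def by blast
          qed auto
          then show ?thesis by (auto simp: \<phi>_def)
        qed
        show ?thesis
        proof (cases "S \<subseteq> v")
          case True
          have "\<phi> S \<subseteq> ?ker i \<inter> ?ker j" using ij by (auto simp: \<phi>_def)
          moreover have "\<phi> v \<subseteq> \<phi> S" using True by (auto simp: \<phi>_def)
          ultimately have "\<phi> S = \<phi> v" using le by auto
          then show ?thesis using v S by (auto simp: flats_def)
        next
          case False
          then obtain k where k: "k \<in> S" "k \<notin> v" by auto
          then have "\<not> concurrent L i j k" "k \<noteq> i" "k \<noteq> j" using concurrent_iff[OF L] v ij by auto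
          then have "bracket (M i) (M j) (M k) \<noteq> 0"
            using representsD[OF M, of i j k] ij k S by auto
          then have "x = 0" if "x \<in> \<phi> S" for x
            using bracket_eq_0_if_common_zero[of x "M i" "M j" "M k"] that ij k
            by (auto simp: \<phi>_def form_ker_def)
          moreover have "0 \<in> \<phi> T" for T by (auto simp: \<phi>_def form_ker_def scalar_product_3)
          moreover have "\<phi> (lines L) \<subseteq> \<phi> S" using S by (auto simp: \<phi>_def)
          ultimately have "\<phi> S = \<phi> (lines L)" by blast
          then show ?thesis using S by (auto simp: flats_def)
        qed
      qed (use S in auto)
    qed
  qed
  ultimately have bij: "bij_betw \<phi> (flats L) (intersection_lattice (?ker ` lines L))"
    by (simp add: bij_betw_def)
  show ?thesis
    unfolding realizations_def
  proof (intro CollectI conjI exI[of _ \<phi>] ballI)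
    show "F \<subseteq> G \<longleftrightarrow> \<phi> G \<subseteq> \<phi> F" if "F \<in> flats L" "G \<in> flats L" for F G
      by (rule order[OF that])
    show "\<phi> {i} = ?ker i" for i by (simp add: \<phi>_def)
  qed (use assms(2) inj bij nz in simp_all)
qed

lemma realizations_iff:
  assumes "rank_three_matroid L"
  shows "M \<in> realizations L \<longleftrightarrow> M \<in> matrices (lines L) \<and> represents L M"
proof
  assume "M \<in> realizations L"
  then show "M \<in> matrices (lines L) \<and> represents L M"
    using represents_if_realization[OF assms] by (simp add: realizations_def)
next
  assume "M \<in> matrices (lines L) \<and> represents L M"
  then show "M \<in> realizations L" using realization_if_represents[OF assms] by blast
qed

section \<open>Projective equivalence and the topology of the moduli space\<close>

text \<open>Rescaling of the columns and a projective transformation in one step.\<close>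

definition proj_equiv :: "'l matroid3 \<Rightarrow> ('l \<Rightarrow> 'k::field ^ 3) \<Rightarrow> ('l \<Rightarrow> 'k ^ 3) \<Rightarrow> bool" where
  "proj_equiv L M N \<longleftrightarrow>
     (\<exists>A c. invertible A \<and> (\<forall>i\<in>lines L. c i \<noteq> 0 \<and> N i = c i *s (A *v M i)))"

lemma proj_equiv_refl: "proj_equiv L M M"
  unfolding proj_equiv_def
  by (rule exI[of _ "mat 1"], rule exI[of _ "\<lambda>_. 1"]) (simp add: invertible_def)

lemma proj_equiv_sym:
  assumes "proj_equiv L M N"
  shows "proj_equiv L N M"
proof -
  obtain A c where A: "invertible A" and c: "\<And>i. i \<in> lines L \<Longrightarrow> c i \<noteq> 0 \<and> N i = c i *s (A *v M i)"
    using assms by (auto simp: proj_equiv_def)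
  obtain B where B: "A ** B = mat 1" "B ** A = mat 1" using A by (auto simp: invertible_def)
  have "M i = inverse (c i) *s (B *v N i)" if "i \<in> lines L" for i
    using c[OF that] B
    by (simp add: vector_scalar_commute matrix_vector_mul_assoc vector_smult_assoc)
  moreover have "invertible B" using B by (auto simp: invertible_def)
  ultimately show ?thesis
    unfolding proj_equiv_def using c by (intro exI[of _ B] exI[of _ "\<lambda>i. inverse (c i)"]) auto
qed

lemma proj_equiv_trans:
  assumes "proj_equiv L M N" "proj_equiv L N P"
  shows "proj_equiv L M P"
proof -
  obtain A c where A: "invertible A" and c: "\<And>i. i \<in> lines L \<Longrightarrow> c i \<noteq> 0 \<and> N i = c i *s (A *v M i)"
    using assms(1) by (auto simp: proj_equiv_def)
  obtain B d where B: "invertible B" and d: "\<And>i. i \<in> lines L \<Longrightarrow> d i \<noteq> 0 \<and> P i = d i *s (B *v N i)"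
    using assms(2) by (auto simp: proj_equiv_def)
  have "P i = (d i * c i) *s ((B ** A) *v M i)" if "i \<in> lines L" for i
    using c[OF that] d[OF that]
    by (simp add: vector_scalar_commute vector_smult_assoc flip: matrix_vector_mul_assoc)
  moreover have "invertible (B ** A)" using A B by (rule invertible_mult[rotated])
  ultimately show ?thesis
    unfolding proj_equiv_def using c d
    by (intro exI[of _ "B ** A"] exI[of _ "\<lambda>i. d i * c i"]) auto
qed

lemma bracket_proj_equiv:
  assumes "proj_equiv L M N"
  obtains \<delta> c where "\<delta> \<noteq> 0" "\<And>i. i \<in> lines L \<Longrightarrow> c i \<noteq> 0"
    "\<And>i j k. i \<in> lines L \<Longrightarrow> j \<in> lines L \<Longrightarrow> k \<in> lines L \<Longrightarrow>
       bracket (N i) (N j) (N k) = \<delta> * c i * c j * c k * bracket (M i) (M j) (M k)"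
proof -
  obtain A c where A: "invertible A" and c: "\<And>i. i \<in> lines L \<Longrightarrow> c i \<noteq> 0 \<and> N i = c i *s (A *v M i)"
    using assms by (auto simp: proj_equiv_def)
  show ?thesis
  proof (rule that[of "det A" c])
    show "det A \<noteq> 0" using A by (simp add: invertible_det_nz)
  qed (use c in \<open>simp_all add: bracket_scale bracket_mult\<close>)
qed

lemma represents_proj_equiv:
  assumes "proj_equiv L M N" "represents L M"
  shows "represents L N"
proof -
  obtain \<delta> c where "\<delta> \<noteq> 0" "\<And>i. i \<in> lines L \<Longrightarrow> c i \<noteq> 0"
    "\<And>i j k. i \<in> lines L \<Longrightarrow> j \<in> lines L \<Longrightarrow> k \<in> lines L \<Longrightarrow>
       bracket (N i) (N j) (N k) = \<delta> * c i * c j * c k * bracket (M i) (M j) (M k)"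
    using bracket_proj_equiv[OF assms(1)] by blast
  then show ?thesis using assms(2) by (simp add: represents_def)
qed

definition moduli_class :: "'l matroid3 \<Rightarrow> ('l \<Rightarrow> 'k::field ^ 3) \<Rightarrow> ('l \<Rightarrow> 'k ^ 3) set set" where
  "moduli_class L M = pgl_rel L `` {torus_rel L `` {M}}"

lemma torus_class_self:
  assumes "M \<in> realizations L"
  shows "M \<in> torus_rel L `` {M}"
proof -
  have "M \<in> extensional (lines L)"
    using assms by (auto simp: realizations_def matrices_def PiE_def)
  then have "M = (\<lambda>i\<in>lines L. 1 *s M i)" by (simp add: extensional_restrict)
  then show ?thesis
    using assms by (auto simp: torus_rel_def intro!: exI[of _ "\<lambda>_. 1"])
qed

lemma pgl_rel_iff:
  fixes M N :: "'l \<Rightarrow> 'k::field ^ 3"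
  assumes L: "rank_three_matroid L" and M: "M \<in> realizations L" and N: "N \<in> realizations L"
  shows "(torus_rel L `` {M}, torus_rel L `` {N}) \<in> pgl_rel L \<longleftrightarrow> proj_equiv L M N"
proof
  assume "(torus_rel L `` {M}, torus_rel L `` {N}) \<in> pgl_rel L"
  then obtain A :: "'k ^ 3 ^ 3" where A: "invertible A"
    "torus_rel L `` {N} = (\<lambda>M. \<lambda>i\<in>lines L. A *v M i) ` (torus_rel L `` {M})"
    by (auto simp: pgl_rel_def)
  then obtain P where P: "(M, P) \<in> torus_rel L" "N = (\<lambda>i\<in>lines L. A *v P i)"
    using torus_class_self[OF N] by auto
  then obtain c where "\<And>i. i \<in> lines L \<Longrightarrow> c i \<noteq> 0" "P = (\<lambda>i\<in>lines L. c i *s M i)"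
    by (auto simp: torus_rel_def)
  then show "proj_equiv L M N"
    using A(1) P(2) unfolding proj_equiv_def
    by (intro exI[of _ A] exI[of _ c]) (simp add: vector_scalar_commute)
next
  assume "proj_equiv L M N"
  then obtain A c where A: "invertible A"
    and c: "\<And>i. i \<in> lines L \<Longrightarrow> c i \<noteq> 0 \<and> N i = c i *s (A *v M i)"
    by (auto simp: proj_equiv_def)
  have scaled: "(\<lambda>i\<in>lines L. d i *s Q i) \<in> realizations L"
    if Q: "Q \<in> realizations L" and d: "\<And>i. i \<in> lines L \<Longrightarrow> d i \<noteq> 0"
    for d and Q :: "'l \<Rightarrow> 'k ^ 3"
  proof -
    have "proj_equiv L Q (\<lambda>i\<in>lines L. d i *s Q i)"
      unfolding proj_equiv_def using d
      by (intro exI[of _ "mat 1"] exI[of _ d]) (simp add: invertible_def)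
    then show ?thesis
      using represents_proj_equiv Q unfolding realizations_iff[OF L] by (auto simp: matrices_def)
  qed
  have "torus_rel L `` {N} = (\<lambda>M. \<lambda>i\<in>lines L. A *v M i) ` (torus_rel L `` {M})"
  proof (intro equalityI subsetI)
    fix P assume "P \<in> torus_rel L `` {N}"
    then obtain d where d: "\<And>i. i \<in> lines L \<Longrightarrow> d i \<noteq> 0" "P = (\<lambda>i\<in>lines L. d i *s N i)"
      by (auto simp: torus_rel_def)
    let ?Q = "\<lambda>i\<in>lines L. (d i * c i) *s M i"
    have "?Q \<in> torus_rel L `` {M}"
      using scaled[OF M, of "\<lambda>i. d i * c i"] c d M
      by (auto simp: torus_rel_def intro!: exI[of _ "\<lambda>i. d i * c i"])
    moreover have "P = (\<lambda>i\<in>lines L. A *v ?Q i)"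
      unfolding d(2) using c
      by (intro restrict_ext) (simp add: vector_scalar_commute vector_smult_assoc)
    ultimately show "P \<in> (\<lambda>M. \<lambda>i\<in>lines L. A *v M i) ` (torus_rel L `` {M})" by blast
  next
    fix P assume "P \<in> (\<lambda>M. \<lambda>i\<in>lines L. A *v M i) ` (torus_rel L `` {M})"
    then obtain d where d: "\<And>i. i \<in> lines L \<Longrightarrow> d i \<noteq> 0"
      "P = (\<lambda>i\<in>lines L. A *v (\<lambda>i\<in>lines L. d i *s M i) i)"
      unfolding torus_rel_def by blast
    have "P = (\<lambda>i\<in>lines L. (d i / c i) *s N i)"
      unfolding d(2) using c
      by (intro restrict_ext) (simp add: vector_scalar_commute vector_smult_assoc)
    then show "P \<in> torus_rel L `` {N}"
      using scaled[OF N, of "\<lambda>i. d i / c i"] c d(1) N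
      by (auto simp: torus_rel_def intro!: exI[of _ "\<lambda>i. d i / c i"])
  qed
  then show "(torus_rel L `` {M}, torus_rel L `` {N}) \<in> pgl_rel L"
    using A M N by (auto simp: pgl_rel_def quotient_def)
qed

lemma moduli_class_eq_iff:
  fixes M N :: "'l \<Rightarrow> 'k::field ^ 3"
  assumes L: "rank_three_matroid L" and M: "M \<in> realizations L" and N: "N \<in> realizations L"
  shows "moduli_class L M = moduli_class L N \<longleftrightarrow> proj_equiv L M N"
proof -
  have mem: "Z \<in> moduli_class L M \<longleftrightarrow>
      (\<exists>P\<in>realizations L. Z = torus_rel L `` {P} \<and> proj_equiv L M P)"
    if M: "M \<in> realizations L" for M :: "'l \<Rightarrow> 'k ^ 3" and Z
  proof
    assume "Z \<in> moduli_class L M"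
    then have "(torus_rel L `` {M}, Z) \<in> pgl_rel L" by (simp add: moduli_class_def)
    moreover from this obtain P where "P \<in> realizations L" "Z = torus_rel L `` {P}"
      by (auto simp: pgl_rel_def elim!: quotientE)
    ultimately show "\<exists>P\<in>realizations L. Z = torus_rel L `` {P} \<and> proj_equiv L M P"
      using pgl_rel_iff[OF L M] by blast
  qed (use pgl_rel_iff[OF L M] in \<open>auto simp: moduli_class_def\<close>)
  show ?thesis
  proof
    assume eq: "moduli_class L M = moduli_class L N"
    have "torus_rel L `` {N} \<in> moduli_class L N" using mem[OF N] N proj_equiv_refl by blast
    then have "(torus_rel L `` {M}, torus_rel L `` {N}) \<in> pgl_rel L"
      unfolding eq[symmetric] by (simp add: moduli_class_def)
    then show "proj_equiv L M N" using pgl_rel_iff[OF L M N] by simp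
  next
    assume "proj_equiv L M N"
    then have "proj_equiv L M P \<longleftrightarrow> proj_equiv L N P" for P
      using proj_equiv_trans proj_equiv_sym by metis
    then show "moduli_class L M = moduli_class L N"
      using mem[OF M] mem[OF N] by (intro set_eqI) simp
  qed
qed

lemma moduli_space_eq: "moduli_space L = moduli_class L ` realizations L"
  by (auto simp: moduli_space_def moduli_class_def quotient_def)

text \<open>The composite of the two quotient maps is again a quotient map, so closed sets of the moduli
  space are detected on matrices.\<close>

lemma closedin_moduli_topology:
  fixes L :: "'l matroid3" and Z :: "('l \<Rightarrow> 'k::field ^ 3) set set set"
  shows "closedin (moduli_topology L) Z \<longleftrightarrow> Z \<subseteq> moduli_space L \<and>
     (\<exists>F \<subseteq> Collect (polynomial_map (lines L)).
        {M \<in> realizations L. moduli_class L M \<in> Z} = realizations L \<inter> zero_locus (lines L) F)"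
proof -
  let ?X = "subtopology (zariski_topology (lines L)) (realizations L)"
  have top: "topspace ?X = realizations L" by (auto simp: realizations_def)
  have "quotient_map ?X (moduli_topology L) (moduli_class L)"
    using quotient_map_compose[OF quotient_map_quotient_topology quotient_map_quotient_topology]
    unfolding moduli_topology_def moduli_class_def comp_def .
  then have "Z \<subseteq> moduli_space L \<Longrightarrow>
      closedin (moduli_topology L) Z \<longleftrightarrow> closedin ?X {M \<in> realizations L. moduli_class L M \<in> Z}"
    unfolding quotient_map_closedin topspace_moduli_topology top by blast
  moreover have "closedin (moduli_topology L) Z \<Longrightarrow> Z \<subseteq> moduli_space L"
    using closedin_subset topspace_moduli_topology by metis
  moreover have "closedin ?X S \<longleftrightarrow> (\<exists>F \<subseteq> Collect (polynomial_map (lines L)).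
      S = realizations L \<inter> zero_locus (lines L) F)" for S :: "('l \<Rightarrow> 'k ^ 3) set"
    unfolding closedin_subtopology closedin_zariski by blast
  ultimately show ?thesis by blast
qed

section \<open>Krull dimension of a finite union of cofinite spaces\<close>

lemma irreducible_closed_subset_of_union:
  assumes Z: "irreducible_closed X Z" and "finite I" and "\<And>i. i \<in> I \<Longrightarrow> closedin X (V i)"
    and "Z \<subseteq> (\<Union>i\<in>I. V i)"
  shows "\<exists>i\<in>I. Z \<subseteq> V i"
  using assms(2-4)
proof (induction I)
  case empty
  then show ?case using Z by (simp add: irreducible_closed_def)
next
  case (insert i I)
  have "closedin X (\<Union>j\<in>I. V j)" using insert by (intro closedin_Union) auto
  moreover have "closedin X (V i)" "Z \<subseteq> V i \<union> (\<Union>j\<in>I. V j)" using insert.prems by auto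
  ultimately have "Z \<subseteq> V i \<or> Z \<subseteq> (\<Union>j\<in>I. V j)" using Z unfolding irreducible_closed_def by blast
  then show ?case using insert by blast
qed

text \<open>An irreducible closed set lies in one of the pieces; there a proper closed subset is finite,
  and a finite irreducible closed set is a single point. So chains have at most two members.\<close>

lemma krull_dim_finite_union_cofinite:
  assumes top: "topspace X = (\<Union>i\<in>I. V i)" and I: "finite I" "I \<noteq> {}"
    and closed: "\<And>i. i \<in> I \<Longrightarrow> closedin X (V i)"
    and inf: "\<And>i. i \<in> I \<Longrightarrow> infinite (V i)"
    and cofinite: "\<And>i Z. i \<in> I \<Longrightarrow> closedin X Z \<Longrightarrow> finite (Z \<inter> V i) \<or> V i \<subseteq> Z"
    and points: "\<And>x. x \<in> topspace X \<Longrightarrow> closedin X {x}"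
  shows "krull_dim X = 1"
proof -
  let ?chain = "\<lambda>n. \<exists>Z :: nat \<Rightarrow> 'a set.
    (\<forall>i\<le>n. irreducible_closed X (Z i)) \<and> (\<forall>i<n. Z i \<subset> Z (Suc i))"
  have finite_irreducible: "\<exists>x. Z = {x}" if Z: "irreducible_closed X Z" "finite Z" for Z
  proof -
    have "Z \<subseteq> topspace X" using Z closedin_subset by (auto simp: irreducible_closed_def)
    then have "\<exists>x\<in>Z. Z \<subseteq> {x}"
      using Z points by (intro irreducible_closed_subset_of_union[of X]) auto
    then show ?thesis by auto
  qed
  have "?chain 1"
  proof -
    obtain i where i: "i \<in> I" using I by auto
    then obtain x where x: "x \<in> V i" using inf[of i] by (metis ex_in_conv finite.emptyI)
    have "irreducible_closed X (V i)"
      unfolding irreducible_closed_def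
    proof (intro conjI allI impI)
      fix A B assume AB: "closedin X A \<and> closedin X B \<and> V i \<subseteq> A \<union> B"
      then have "V i = (A \<inter> V i) \<union> (B \<inter> V i)" by auto
      then have "\<not> (finite (A \<inter> V i) \<and> finite (B \<inter> V i))" using inf[OF i] by (metis finite_UnI)
      then show "V i \<subseteq> A \<or> V i \<subseteq> B" using cofinite[OF i] AB by blast
    qed (use x closed i in auto)
    moreover have "irreducible_closed X {x}"
      using points x i top by (auto simp: irreducible_closed_def)
    moreover have "{x} \<noteq> V i" using inf[OF i] by (metis finite.emptyI finite.insertI)
    then have "{x} \<subset> V i" using x by auto
    ultimately show ?thesis
      by (intro exI[of _ "\<lambda>n. if n = 0 then {x} else V i"]) auto
  qed
  moreover have "n \<le> 1" if n: "?chain n" for n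
  proof (rule ccontr)
    assume "\<not> n \<le> 1"
    obtain Z where Z: "\<And>i. i \<le> n \<Longrightarrow> irreducible_closed X (Z i)" "\<And>i. i < n \<Longrightarrow> Z i \<subset> Z (Suc i)"
      using n by blast
    have irr: "irreducible_closed X (Z 0)" "irreducible_closed X (Z 1)" "irreducible_closed X (Z 2)"
      and strict: "Z 0 \<subset> Z 1" "Z 1 \<subset> Z 2"
      using Z(1)[of 0] Z(1)[of 1] Z(1)[of 2] Z(2)[of 0] Z(2)[of 1] \<open>\<not> n \<le> 1\<close>
      by (simp_all add: numeral_2_eq_2)
    have "Z 2 \<subseteq> topspace X" using irr closedin_subset by (auto simp: irreducible_closed_def)
    then obtain i where i: "i \<in> I" "Z 2 \<subseteq> V i"
      using irreducible_closed_subset_of_union[OF irr(3) I(1), of V] closed top by auto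
    then have "\<not> V i \<subseteq> Z 1" "Z 1 \<inter> V i = Z 1" using strict by auto
    moreover have "closedin X (Z 1)" using irr by (simp add: irreducible_closed_def)
    ultimately have "finite (Z 1)" using cofinite[OF i(1), of "Z 1"] by auto
    then obtain x where "Z 1 = {x}" using finite_irreducible irr by blast
    then have "Z 0 = {}" using strict by auto
    then show False using irr by (simp add: irreducible_closed_def)
  qed
  ultimately have chain: "?chain 1" "\<And>n. ?chain n \<Longrightarrow> n \<le> 1" by blast+
  show ?thesis
    unfolding krull_dim_def
  proof (rule Sup_eqI)
    fix y assume "y \<in> {ereal (real n) | n. ?chain n}"
    then obtain n where "y = ereal (real n)" "?chain n" by blast
    then show "y \<le> 1" using chain(2)[of n] by simp
  next
    fix y assume "\<And>z. z \<in> {ereal (real n) | n. ?chain n} \<Longrightarrow> z \<le> y"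
    then have "ereal (real 1) \<le> y" using chain(1) by blast
    then show "1 \<le> y" by (simp add: one_ereal_def)
  qed
qed

section \<open>Generation\<close>

text \<open>The points of a generating sequence are hidden here: each is the intersection of two generated
  lines. The result no longer depends on the order of the construction.\<close>

inductive_set generated_lines :: "'l matroid3 \<Rightarrow> 'l set \<Rightarrow> 'l set" for L H where
  generator: "h \<in> H \<Longrightarrow> h \<in> generated_lines L H"
| join: "\<lbrakk>a \<in> generated_lines L H; b \<in> generated_lines L H; a \<noteq> b; v \<in> points L; a \<in> v; b \<in> v;
    c \<in> generated_lines L H; d \<in> generated_lines L H; c \<noteq> d; w \<in> points L; c \<in> w; d \<in> w;
    v \<noteq> w; l \<in> v; l \<in> w\<rbrakk> \<Longrightarrow> l \<in> generated_lines L H"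

definition construction :: "'l matroid3 \<Rightarrow> 'l list \<Rightarrow> ('l + 'l set) list \<Rightarrow> bool" where
  "construction L Hs Us \<longleftrightarrow> length Hs \<le> length Us \<and> (\<forall>i<length Hs. Us ! i = Inl (Hs ! i)) \<and>
     (\<forall>i. length Hs \<le> i \<and> i < length Us \<longrightarrow>
        (\<exists>j<i. \<exists>k<i. is_intersection_point L (Us ! j) (Us ! k) (Us ! i) \<or>
                     is_joining_line L (Us ! j) (Us ! k) (Us ! i)))"

lemma construction_snoc:
  assumes Us: "construction L Hs Us" and XY: "X \<in> set Us" "Y \<in> set Us"
    and Z: "is_intersection_point L X Y Z \<or> is_joining_line L X Y Z"
  shows "construction L Hs (Us @ [Z])"
proof -
  obtain j k where jk: "j < length Us" "k < length Us" "Us ! j = X" "Us ! k = Y"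
    using XY by (auto simp: in_set_conv_nth)
  show ?thesis
    unfolding construction_def
  proof (intro conjI allI impI)
    show "length Hs \<le> length (Us @ [Z])" using Us by (simp add: construction_def)
    show "(Us @ [Z]) ! i = Inl (Hs ! i)" if "i < length Hs" for i
      using Us that by (simp add: construction_def nth_append)
    fix i assume i: "length Hs \<le> i \<and> i < length (Us @ [Z])"
    show "\<exists>j<i. \<exists>k<i. is_intersection_point L ((Us @ [Z]) ! j) ((Us @ [Z]) ! k) ((Us @ [Z]) ! i) \<or>
        is_joining_line L ((Us @ [Z]) ! j) ((Us @ [Z]) ! k) ((Us @ [Z]) ! i)"
    proof (cases "i < length Us")
      case True
      then obtain j' k' where "j' < i" "k' < i" "is_intersection_point L (Us ! j') (Us ! k') (Us ! i) \<or>
          is_joining_line L (Us ! j') (Us ! k') (Us ! i)"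
        using Us i unfolding construction_def by blast
      then show ?thesis
        using True by (intro exI[of _ j'] conjI exI[of _ k']) (simp_all add: nth_append)
    next
      case False
      then have "i = length Us" using i by simp
      then show ?thesis
        using jk Z by (intro exI[of _ j] conjI exI[of _ k]) (simp_all add: nth_append)
    qed
  qed
qed

lemma generates_iff:
  assumes L: "rank_three_matroid L"
  shows "generates L Hs \<longleftrightarrow> set Hs \<subseteq> lines L \<and> lines L \<subseteq> generated_lines L (set Hs)"
proof
  assume "generates L Hs"
  then obtain Us where Hs: "set Hs \<subseteq> lines L" and Us: "construction L Hs Us"
    and all: "\<And>a. a \<in> lines L \<Longrightarrow> Inl a \<in> set Us"
    unfolding generates_def construction_def by blast
  let ?G = "generated_lines L (set Hs)"
  have gen: "(\<forall>a. Us ! i = Inl a \<longrightarrow> a \<in> ?G) \<and>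
      (\<forall>v. Us ! i = Inr v \<longrightarrow> v \<in> points L \<and> (\<exists>a\<in>?G. \<exists>b\<in>?G. a \<noteq> b \<and> a \<in> v \<and> b \<in> v))"
    if "i < length Us" for i
    using that
  proof (induction i rule: less_induct)
    case (less i)
    show ?case
    proof (cases "i < length Hs")
      case True
      then show ?thesis using Us by (auto simp: construction_def intro: generated_lines.generator)
    next
      case False
      then obtain j k where jk: "j < i" "k < i"
        "is_intersection_point L (Us ! j) (Us ! k) (Us ! i) \<or> is_joining_line L (Us ! j) (Us ! k) (Us ! i)"
        using Us less.prems unfolding construction_def by (meson not_less)
      note IH = less.IH[OF jk(1)] less.IH[OF jk(2)]
      from jk(3) show ?thesis
      proof
        assume "is_intersection_point L (Us ! j) (Us ! k) (Us ! i)"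
        then obtain a b v where abv: "a \<noteq> b" "v \<in> points L" "a \<in> v" "b \<in> v"
          "Us ! j = Inl a" "Us ! k = Inl b" "Us ! i = Inr v" by (auto simp: is_intersection_point_def)
        then have "a \<in> ?G" "b \<in> ?G" using IH jk less.prems by auto
        then show ?thesis using abv by auto
      next
        assume "is_joining_line L (Us ! j) (Us ! k) (Us ! i)"
        then obtain v w l where vwl: "v \<noteq> w" "Us ! j = Inr v" "Us ! k = Inr w" "l \<in> v" "l \<in> w"
          "Us ! i = Inl l" by (auto simp: is_joining_line_def)
        then have "v \<in> points L \<and> (\<exists>a\<in>?G. \<exists>b\<in>?G. a \<noteq> b \<and> a \<in> v \<and> b \<in> v)"
          "w \<in> points L \<and> (\<exists>a\<in>?G. \<exists>b\<in>?G. a \<noteq> b \<and> a \<in> w \<and> b \<in> w)"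
          using IH jk less.prems by auto
        then have "l \<in> ?G"
          using vwl by (elim conjE bexE) (rule generated_lines.join[where v = v and w = w])
        then show ?thesis using vwl by simp
      qed
    qed
  qed
  have "a \<in> ?G" if "a \<in> lines L" for a
    using all[OF that] gen by (auto simp: in_set_conv_nth)
  then show "set Hs \<subseteq> lines L \<and> lines L \<subseteq> ?G" using Hs by auto
next
  assume Hs: "set Hs \<subseteq> lines L \<and> lines L \<subseteq> generated_lines L (set Hs)"
  have extend: "\<exists>Vs. construction L Hs Vs \<and> set Us \<subseteq> set Vs \<and> Inl l \<in> set Vs"
    if "l \<in> generated_lines L (set Hs)" "construction L Hs Us" for l Us
    using that
  proof (induction arbitrary: Us)
    case (generator h)
    then obtain i where "i < length Hs" "Hs ! i = h" by (auto simp: in_set_conv_nth)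
    then have "Inl h \<in> set Us"
      using generator.prems by (metis construction_def nth_mem order_less_le_trans)
    then show ?case using generator.prems by blast
  next
    case (join a b v c d w l)
    obtain V1 where V1: "construction L Hs V1" "set Us \<subseteq> set V1" "Inl a \<in> set V1"
      using join.IH(1) join.prems by blast
    obtain V2 where V2: "construction L Hs V2" "set V1 \<subseteq> set V2" "Inl b \<in> set V2"
      using join.IH(2) V1 by blast
    obtain V3 where V3: "construction L Hs V3" "set V2 \<subseteq> set V3" "Inl c \<in> set V3"
      using join.IH(3) V2 by blast
    obtain V4 where V4: "construction L Hs V4" "set V3 \<subseteq> set V4" "Inl d \<in> set V4"
      using join.IH(4) V3 by blast
    have in_lines: "x \<in> lines L" if "x \<in> v \<or> x \<in> w" for x
      using that L join.hyps unfolding rank_three_matroid_def by blast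
    have "is_intersection_point L (Inl a) (Inl b) (Inr v)" "is_intersection_point L (Inl c) (Inl d) (Inr w)"
      "is_joining_line L (Inr v) (Inr w) (Inl l)"
      using join.hyps in_lines by (auto simp: is_intersection_point_def is_joining_line_def)
    note steps = this(1,2)[THEN disjI1] this(3)[THEN disjI2]
    have "construction L Hs (V4 @ [Inr v])"
      using V1 V2 V3 V4 by (intro construction_snoc[OF _ _ _ steps(1)]) auto
    then have "construction L Hs ((V4 @ [Inr v]) @ [Inr w])"
      using V3 V4 by (intro construction_snoc[OF _ _ _ steps(2)]) auto
    then have "construction L Hs (((V4 @ [Inr v]) @ [Inr w]) @ [Inl l])"
      by (rule construction_snoc[OF _ _ _ steps(3)]) auto
    then show ?case using V1 V2 V3 V4 by (intro exI[of _ "((V4 @ [Inr v]) @ [Inr w]) @ [Inl l]"]) auto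
  qed
  have "\<exists>Us. construction L Hs Us \<and> Inl ` S \<subseteq> set Us" if "finite S" "S \<subseteq> lines L" for S
    using that
  proof (induction S)
    case empty
    have "construction L Hs (map Inl Hs)" by (auto simp: construction_def)
    then show ?case by auto
  next
    case (insert l S)
    then obtain Us where "construction L Hs Us" "Inl ` S \<subseteq> set Us" by auto
    moreover have "l \<in> generated_lines L (set Hs)" using insert.prems Hs by auto
    ultimately show ?case using extend[of l Us] by auto
  qed
  moreover have "finite (lines L)" using L by (simp add: rank_three_matroid_def)
  ultimately obtain Us where "construction L Hs Us" "Inl ` lines L \<subseteq> set Us" by blast
  then show "generates L Hs"
    unfolding generates_def construction_def
    by (intro conjI exI[of _ Us]) (use Hs in auto)
qed

definition join_closed :: "'l matroid3 \<Rightarrow> 'l set \<Rightarrow> bool" where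
  "join_closed L S \<longleftrightarrow> (\<forall>a\<in>S. \<forall>b\<in>S. \<forall>c\<in>S. \<forall>d\<in>S. \<forall>v\<in>points L. \<forall>w\<in>points L. \<forall>l.
     a \<noteq> b \<and> c \<noteq> d \<and> v \<noteq> w \<and> {a, b, l} \<subseteq> v \<and> {c, d, l} \<subseteq> w \<longrightarrow> l \<in> S)"

lemma generated_lines_subset:
  assumes "H \<subseteq> S" "join_closed L S"
  shows "generated_lines L H \<subseteq> S"
proof
  fix l assume "l \<in> generated_lines L H"
  then show "l \<in> S"
  proof induction
    case (join a b v c d w l)
    have *: "{a, b, l} \<subseteq> v" "{c, d, l} \<subseteq> w" using join by auto
    show ?case
      using assms(2)[unfolded join_closed_def, rule_format, of a b c d v w l] join * by blast
  qed (use assms(1) in auto)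
qed

text \<open>The two points witnessing a missing join share no line besides the missing one, so the four
  lines through them are distinct.\<close>

lemma not_join_closedE:
  assumes L: "rank_three_matroid L" and nc: "\<not> join_closed L S"
  obtains l a b c d v w where "l \<notin> S" "{a, b} \<subseteq> S" "{c, d} \<subseteq> S" "distinct [a, b, c, d]"
    "v \<in> points L" "w \<in> points L" "v \<noteq> w" "{a, b, l} \<subseteq> v" "{c, d, l} \<subseteq> w"
proof (rule ccontr)
  assume "\<not> thesis"
  have "join_closed L S"
    unfolding join_closed_def
  proof (intro ballI allI impI)
    fix a b c d v w l
    assume in_S: "a \<in> S" "b \<in> S" "c \<in> S" "d \<in> S" and vw: "v \<in> points L" "w \<in> points L"
      and *: "a \<noteq> b \<and> c \<noteq> d \<and> v \<noteq> w \<and> {a, b, l} \<subseteq> v \<and> {c, d, l} \<subseteq> w"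
    show "l \<in> S"
    proof (rule ccontr)
      assume "l \<notin> S"
      have "x \<notin> w" if "x \<in> v" "x \<noteq> l" for x
        using points_eq[OF L vw, of x l] that * by auto
      then have "distinct [a, b, c, d]" using * in_S \<open>l \<notin> S\<close> by auto
      then have thesis using that[of l a b c d v w] \<open>l \<notin> S\<close> in_S vw * by simp
      with \<open>\<not> thesis\<close> show False by contradiction
    qed
  qed
  then show False using nc by contradiction
qed

text \<open>The line \<open>m\<close> has only one point with more than two lines, so it is never the join of two
  points constructed from other lines, and must itself be a generator. Three further generators
  yield at most one new line, namely the join of \<open>p\<close> with the intersection of two of them, and
  the resulting five lines have no further joins.\<close>

lemma four_generators_insufficient:
  assumes L: "rank_three_matroid L" and large: "card (lines L) > 5"
    and p: "p \<in> points L" "m \<in> p"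
    and double: "\<And>v. v \<in> points L \<Longrightarrow> m \<in> v \<Longrightarrow> v \<noteq> p \<Longrightarrow> card v = 2"
    and gen: "generates L Hs"
  shows "length Hs > 4"
proof (rule ccontr)
  assume "\<not> length Hs > 4"
  let ?H = "set Hs"
  have H: "card ?H \<le> 4" using \<open>\<not> length Hs > 4\<close> card_length[of Hs] by linarith
  have all: "lines L \<subseteq> generated_lines L ?H" using gen generates_iff[OF L] by blast
  have m_line: "m \<in> lines L" using L p by (auto simp: rank_three_matroid_def)
  have eq_p: "v = p" if "v \<in> points L" "m \<in> v" "b \<in> v" "l \<in> v" "distinct [m, b, l]" for v b l
  proof (rule ccontr)
    assume "v \<noteq> p"
    then have "card v = 2" using double that by simp
    moreover have "finite v" using L that unfolding rank_three_matroid_def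
      by (meson psubset_imp_subset finite_subset)
    moreover have "{m, b, l} \<subseteq> v" "card {m, b, l} = 3" using that by auto
    ultimately show False using card_mono[of v "{m, b, l}"] by simp
  qed
  have not_closed: "\<not> join_closed L S" if "?H \<subseteq> S" "finite S" "card S \<le> 5" for S
  proof
    assume "join_closed L S"
    then have "lines L \<subseteq> S" using generated_lines_subset that(1) all by blast
    then show False using card_mono[of S "lines L"] that large by simp
  qed
  have m: "m \<in> ?H"
  proof (rule ccontr)
    assume m: "m \<notin> ?H"
    have "join_closed L (lines L - {m})"
    proof (rule ccontr)
      assume "\<not> join_closed L (lines L - {m})"
      then obtain l a b c d v w where *: "l \<notin> lines L - {m}" "{a, b} \<subseteq> lines L - {m}"
        "{c, d} \<subseteq> lines L - {m}" "distinct [a, b, c, d]" "v \<in> points L" "w \<in> points L" "v \<noteq> w"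
        "{a, b, l} \<subseteq> v" "{c, d, l} \<subseteq> w"
        by (rule not_join_closedE[OF L])
      then have "l = m" using L by (auto simp: rank_three_matroid_def)
      then have "v = p" "w = p" using eq_p[of v a b] eq_p[of w c d] * by auto
      then show False using * by simp
    qed
    moreover have "?H \<subseteq> lines L - {m}" using gen m by (auto simp: generates_def)
    ultimately show False using generated_lines_subset all m_line by blast
  qed
  have "\<not> join_closed L ?H" using not_closed H by simp
  then obtain l a b c d v w where one: "l \<notin> ?H" "{a, b} \<subseteq> ?H" "{c, d} \<subseteq> ?H" "distinct [a, b, c, d]"
    "v \<in> points L" "w \<in> points L" "v \<noteq> w" "{a, b, l} \<subseteq> v" "{c, d, l} \<subseteq> w"
    by (rule not_join_closedE[OF L])
  have "card {a, b, c, d} = 4" using one(4) by simp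
  then have H_eq: "?H = {a, b, c, d}"
    using card_seteq[of ?H "{a, b, c, d}"] H one(2,3) by auto
  \<comment> \<open>Up to symmetry \<open>a\<close> is the special line \<open>m\<close>, so that \<open>l\<close> joins \<open>p\<close> to the point \<open>c \<inter> d\<close>.\<close>
  let ?Q = "\<lambda>b c d w. ?H = {m, b, c, d} \<and> distinct [m, b, c, d, l] \<and> w \<in> points L \<and> w \<noteq> p \<and>
      {m, b, l} \<subseteq> p \<and> {c, d, l} \<subseteq> w"
  have special: "?Q b' c' d' w'"
    if "?H = {m, b', c', d'}" "distinct [m, b', c', d']" "v' \<in> points L" "w' \<in> points L" "v' \<noteq> w'"
      "{m, b', l} \<subseteq> v'" "{c', d', l} \<subseteq> w'" for b' c' d' v' w'
  proof -
    have dist: "distinct [m, b', c', d', l]" using that(1,2) one(1) by auto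
    then have "v' = p" using eq_p[of v' b' l] that(3,6) by simp
    then show ?thesis using that dist by simp
  qed
  have "\<exists>b c d w. ?Q b c d w"
  proof -
    note rest = one(5-9)
    consider "m = a" | "m = b" | "m = c" | "m = d" using m H_eq by blast
    then show ?thesis
    proof cases
      case 1
      have "?Q b c d w"
        by (rule special[of b c d v w]) (use 1 H_eq one(4) rest in auto)
      then show ?thesis by (intro exI[of _ b] exI[of _ c] exI[of _ d] exI[of _ w])
    next
      case 2
      have "?Q a c d w"
        by (rule special[of a c d v w]) (use 2 H_eq one(4) rest in auto)
      then show ?thesis by (intro exI[of _ a] exI[of _ c] exI[of _ d] exI[of _ w])
    next
      case 3
      have "?Q d a b v"
        by (rule special[of d a b w v]) (use 3 H_eq one(4) rest in auto)
      then show ?thesis by (intro exI[of _ d] exI[of _ a] exI[of _ b] exI[of _ v])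
    next
      case 4
      have "?Q c a b v"
        by (rule special[of c a b w v]) (use 4 H_eq one(4) rest in auto)
      then show ?thesis by (intro exI[of _ c] exI[of _ a] exI[of _ b] exI[of _ v])
    qed
  qed
  then obtain b c d w where H_eq: "?H = {m, b, c, d}" and dist: "distinct [m, b, c, d, l]"
    and w: "w \<in> points L" "w \<noteq> p" "m \<in> p" "b \<in> p" "l \<in> p" "c \<in> w" "d \<in> w" "l \<in> w" by auto
  let ?S = "{m, b, l, c, d}"
  have "\<not> join_closed L ?S" using H_eq dist by (intro not_closed) auto
  then obtain k a1 b1 c1 d1 v1 w1 where two: "k \<notin> ?S" "{a1, b1} \<subseteq> ?S" "{c1, d1} \<subseteq> ?S"
    "distinct [a1, b1, c1, d1]" "v1 \<in> points L" "w1 \<in> points L" "v1 \<noteq> w1" "{a1, b1, k} \<subseteq> v1" "{c1, d1, k} \<subseteq> w1"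
    by (rule not_join_closedE[OF L])
  have only: "x = y" if "x \<in> p" "x \<in> w" "y \<in> p" "y \<in> w" for x y
    using points_eq[OF L p(1) w(1)] that w(2) by blast
  have misses: "k \<notin> q" if q: "q \<in> points L"
    and off: "\<And>x y u. \<lbrakk>x \<in> ?S; y \<in> ?S; x \<noteq> y; x \<notin> q; y \<notin> q; u \<in> points L; x \<in> u; y \<in> u; k \<in> u; k \<in> q\<rbrakk>
      \<Longrightarrow> False" for q
  proof
    assume k: "k \<in> q"
    have off_q: "x \<notin> q" if "x \<in> ?S" "u \<in> points L" "u \<noteq> q" "x \<in> u" "k \<in> u" for x u
    proof
      assume "x \<in> q"
      moreover have "x \<noteq> k" using that(1) two(1) by blast
      ultimately show False using points_eq[OF L that(2) q that(4,5) _ k] that(3) by simp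
    qed
    have contra: False if "{x, y} \<subseteq> ?S" "x \<noteq> y" "u \<in> points L" "{x, y, k} \<subseteq> u" "u \<noteq> q" for x y u
      using that(1,4) by (intro off[of x y u] off_q[of _ u] that(2,3,5) k) auto
    show False
    proof (cases "v1 = q")
      case True
      then show False using contra[of c1 d1 w1] two(3,4,6,7,9) by simp
    next
      case False
      then show False using contra[of a1 b1 v1] two(2,4,5,8) by simp
    qed
  qed
  \<comment> \<open>Within \<open>?S\<close> only \<open>c\<close> and \<open>d\<close> are off \<open>p\<close>, and only \<open>m\<close> and \<open>b\<close> are off \<open>w\<close>.\<close>
  have k_not_p: "k \<notin> p"
  proof (rule misses[OF p(1)])
    fix x y u assume u: "x \<in> ?S" "y \<in> ?S" "x \<noteq> y" "x \<notin> p" "y \<notin> p" "u \<in> points L" "x \<in> u" "y \<in> u"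
      "k \<in> u" "k \<in> p"
    then have "{x, y} = {c, d}" using w(3-5) by blast
    then have "c \<in> u" "d \<in> u" using u(7,8) by (auto simp: doubleton_eq_iff)
    then have "u = w" using points_eq[OF L u(6) w(1) _ _ w(6,7)] dist by simp
    then have "k = l" using only[of k l] w(5,8) u(9,10) by simp
    then show False using two(1) by simp
  qed
  have k_not_w: "k \<notin> w"
  proof (rule misses[OF w(1)])
    fix x y u assume u: "x \<in> ?S" "y \<in> ?S" "x \<noteq> y" "x \<notin> w" "y \<notin> w" "u \<in> points L" "x \<in> u" "y \<in> u"
      "k \<in> u" "k \<in> w"
    then have "{x, y} = {m, b}" using w(6-8) by blast
    then have "m \<in> u" "b \<in> u" using u(7,8) by (auto simp: doubleton_eq_iff)
    then have "u = p" using points_eq[OF L u(6) p(1) _ _ w(3,4)] dist by simp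
    then show False using k_not_p u(9) by simp
  qed
  \<comment> \<open>So neither of the two points on \<open>k\<close> is \<open>p\<close> or \<open>w\<close>; but \<open>l\<close> meets the other lines of \<open>?S\<close>
    only there, and a point with \<open>m\<close>, \<open>k\<close> and a third line would be \<open>p\<close>.\<close>
  have no_m: "x \<noteq> m" if "y \<in> ?S" "x \<noteq> y" "u \<in> points L" "x \<in> u" "y \<in> u" "k \<in> u" for x y u
  proof
    assume x: "x = m"
    have "m \<noteq> k" "y \<noteq> k" using two(1) that(1) by blast+
    then have "u = p" using eq_p[of u y k] that x by simp
    then show False using k_not_p that(6) by simp
  qed
  have no_l: "x \<noteq> l" if "y \<in> ?S" "x \<noteq> y" "u \<in> points L" "x \<in> u" "y \<in> u" "k \<in> u" for x y u
  proof
    assume x: "x = l"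
    have "y \<in> p \<or> y \<in> w" using that(1) w(3-8) by blast
    then have "u = p \<or> u = w"
      using points_eq[OF L that(3) p(1) that(4,5)] points_eq[OF L that(3) w(1) that(4,5)] x w(5,8) that(2)
      by blast
    then show False using k_not_p k_not_w that(6) by blast
  qed
  have "{x, y} \<subseteq> {b, c, d}" if "{x, y} \<subseteq> ?S" "x \<noteq> y" "u \<in> points L" "{x, y, k} \<subseteq> u" for x y u
  proof -
    have mem: "x \<in> ?S" "y \<in> ?S" "x \<in> u" "y \<in> u" "k \<in> u" using that(1,4) by simp_all
    have "x \<noteq> m" "x \<noteq> l" "y \<noteq> m" "y \<noteq> l"
      using no_m[OF mem(2) that(2,3) mem(3-5)] no_l[OF mem(2) that(2,3) mem(3-5)]
        no_m[OF mem(1) that(2)[symmetric] that(3) mem(4,3,5)]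
        no_l[OF mem(1) that(2)[symmetric] that(3) mem(4,3,5)] by simp_all
    then show ?thesis using mem(1,2) by blast
  qed
  from this[of a1 b1 v1] this[of c1 d1 w1] have "{a1, b1, c1, d1} \<subseteq> {b, c, d}"
    using two(2-9) by simp
  then have "card {a1, b1, c1, d1} \<le> card {b, c, d}" by (intro card_mono) simp_all
  also have "card {b, c, d} \<le> 3" by (simp add: card_insert_if)
  finally show False using two(4) by simp
qed

section \<open>The lines of the matroid as a net over the integers modulo five\<close>

text \<open>The 25 points with three lines off line 1 form a 3-net of order five whose classes are the
  pencils at the points 1, 2 and 3 (without line 1). The lines are listed so that \<open>net_a i\<close>,
  \<open>net_c k\<close> and \<open>net_b j\<close> are concurrent exactly if \<open>j \<equiv> i + k\<close> modulo 5.\<close>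

definition net_a :: "nat \<Rightarrow> nat" where "net_a i = [2, 3, 6, 7, 8] ! i"
definition net_b :: "nat \<Rightarrow> nat" where "net_b i = [4, 10, 11, 5, 9] ! i"
definition net_c :: "nat \<Rightarrow> nat" where "net_c i = [13, 15, 16, 12, 14] ! i"

lemma less_5_cases:
  assumes "i < (5 :: nat)"
  obtains "i = 0" | "i = Suc 0" | "i = 2" | "i = 3" | "i = 4"
  using assms by fastforce

lemma net_simps [simp]:
  "net_a 0 = 2" "net_a (Suc 0) = 3" "net_a 2 = 6" "net_a 3 = 7" "net_a 4 = 8"
  "net_b 0 = 4" "net_b (Suc 0) = 10" "net_b 2 = 11" "net_b (Suc (Suc 0)) = 11" "net_b 3 = 5" "net_b 4 = 9"
  "net_c 0 = 13" "net_c (Suc 0) = 15" "net_c 2 = 16" "net_c 3 = 12" "net_c 4 = 14"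
  by (simp_all add: net_a_def net_b_def net_c_def)

lemma lines_matroid: "lines matroid_16_38 = {1..16}"
  by (simp add: matroid_16_38_def)

lemma lines_matroid_list:
  "lines matroid_16_38 = set [1, 2, 3, 4, 5, 6, 7, 8, 9, 10, 11, 12, 13, 14, 15, 16]"
proof -
  have "{1..16} = set [1..<17::nat]" by auto
  then show ?thesis by (simp add: lines_matroid upt_rec numeral_eq_Suc)
qed

lemma labelled_point_filter:
  "labelled_point k = set (filter (\<lambda>i. k \<in> set (point_labels ! (i - 1)))
     [1, 2, 3, 4, 5, 6, 7, 8, 9, 10, 11, 12, 13, 14, 15, 16])"
  unfolding labelled_point_def lines_matroid[symmetric] lines_matroid_list by (simp only: set_filter)

lemma labelled_points:
  "labelled_point (Suc 0) = {1, 12, 13, 14, 15, 16}"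
  "labelled_point 2 = {2, 3, 6, 7, 8}"
  "labelled_point 3 = {4, 5, 9, 10, 11}"
  "labelled_point 4 = {4, 8, 15}"
  "labelled_point 5 = {2, 4, 13}"
  "labelled_point 6 = {4, 6, 12}"
  "labelled_point 7 = {5, 8, 14}"
  "labelled_point 8 = {7, 10, 12}"
  "labelled_point 9 = {4, 7, 16}"
  "labelled_point 10 = {5, 7, 13}"
  "labelled_point 11 = {3, 5, 16}"
  "labelled_point 12 = {2, 9, 14}"
  "labelled_point 13 = {6, 10, 14}"
  "labelled_point 14 = {8, 10, 16}"
  "labelled_point 15 = {2, 10, 15}"
  "labelled_point 16 = {5, 6, 15}"
  "labelled_point 17 = {6, 11, 13}"
  "labelled_point 18 = {7, 11, 14}"
  "labelled_point 19 = {7, 9, 15}"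
  "labelled_point 20 = {8, 9, 13}"
  "labelled_point 21 = {3, 9, 12}"
  "labelled_point 22 = {3, 10, 13}"
  "labelled_point 23 = {3, 4, 14}"
  "labelled_point 24 = {6, 9, 16}"
  "labelled_point 25 = {3, 11, 15}"
  "labelled_point 26 = {2, 5, 12}"
  "labelled_point 27 = {8, 11, 12}"
  "labelled_point 28 = {2, 11, 16}"
  "labelled_point 29 = {1, 9}"
  "labelled_point 30 = {1, 5}"
  "labelled_point 31 = {1, 7}"
  "labelled_point 32 = {1, 11}"
  "labelled_point 33 = {1, 4}"
  "labelled_point 34 = {1, 10}"
  "labelled_point 35 = {1, 2}"
  "labelled_point 36 = {1, 3}"
  "labelled_point 37 = {1, 8}"
  "labelled_point 38 = {1, 6}"
  by (simp_all add: labelled_point_filter point_labels_nth)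

lemma point_matroidI: "k \<in> {1..38} \<Longrightarrow> labelled_point k = v \<Longrightarrow> v \<in> points matroid_16_38"
  by (auto simp: matroid_16_38_def)

lemma net_images:
  "net_a ` {..<5} = {2, 3, 6, 7, 8}"
  "net_b ` {..<5} = {4, 10, 11, 5, 9}"
  "net_c ` {..<5} = {13, 15, 16, 12, 14}"
proof -
  have "{..<5} = {0, Suc 0, 2, 3, 4}" by (auto elim: less_5_cases)
  then show "net_a ` {..<5} = {2, 3, 6, 7, 8}" "net_b ` {..<5} = {4, 10, 11, 5, 9}"
    "net_c ` {..<5} = {13, 15, 16, 12, 14}" by simp_all
qed

lemma point_a: "net_a ` {..<5} \<in> points matroid_16_38"
  by (rule point_matroidI[of 2]) (simp_all add: labelled_points net_images)

lemma point_b: "net_b ` {..<5} \<in> points matroid_16_38"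
  by (rule point_matroidI[of 3]) (auto simp: labelled_points net_images)

lemma point_c: "insert 1 (net_c ` {..<5}) \<in> points matroid_16_38"
  by (rule point_matroidI[of "Suc 0"]) (auto simp: labelled_points net_images)

lemma point_triple:
  assumes "i < 5" "k < 5"
  shows "{net_a i, net_c k, net_b ((i + k) mod 5)} \<in> points matroid_16_38"
proof -
  let ?label = "[[5, 15, 28, 26, 12], [22, 25, 11, 21, 23], [17, 16, 24, 6, 13], [10, 19, 9, 8, 18],
    [20, 4, 14, 27, 7]] ! i ! k :: nat"
  show ?thesis
    by (rule point_matroidI[of ?label]; rule less_5_cases[OF assms(1)]; rule less_5_cases[OF assms(2)])
      (simp_all add: labelled_points insert_commute)
qed

lemma point_one_a:
  assumes "i < 5"
  shows "{1, net_a i} \<in> points matroid_16_38"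
  by (rule point_matroidI[of "[35, 36, 38, 31, 37] ! i"]; rule less_5_cases[OF assms])
    (simp_all add: labelled_points)

lemma point_one_b:
  assumes "i < 5"
  shows "{1, net_b i} \<in> points matroid_16_38"
  by (rule point_matroidI[of "[33, 34, 32, 30, 29] ! i"]; rule less_5_cases[OF assms])
    (simp_all add: labelled_points)

lemma line_cases:
  assumes "l \<in> lines matroid_16_38"
  obtains (a) i where "i < 5" "l = net_a i" | (b) i where "i < 5" "l = net_b i"
    | (c) i where "i < 5" "l = net_c i" | (one) "l = 1"
proof -
  have "l = 1 \<or> l \<in> {net_a 0, net_a (Suc 0), net_a 2, net_a 3, net_a 4} \<or>
      l \<in> {net_b 0, net_b (Suc 0), net_b 2, net_b 3, net_b 4} \<or>
      l \<in> {net_c 0, net_c (Suc 0), net_c 2, net_c 3, net_c 4}"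
    using assms unfolding lines_matroid_list by auto
  then show ?thesis
    using a[of 0] a[of "Suc 0"] a[of 2] a[of 3] a[of 4] b[of 0] b[of "Suc 0"] b[of 2] b[of 3] b[of 4]
      c[of 0] c[of "Suc 0"] c[of 2] c[of 3] c[of 4] one by (elim disjE insertE emptyE) simp_all
qed

lemma net_in_lines:
  assumes "i < 5"
  shows "net_a i \<in> lines matroid_16_38" "net_b i \<in> lines matroid_16_38" "net_c i \<in> lines matroid_16_38"
  by (rule less_5_cases[OF assms]; simp add: lines_matroid)+

lemma net_neq:
  assumes "i < 5" "j < 5"
  shows "net_a i \<noteq> net_b j" "net_a i \<noteq> net_c j" "net_b i \<noteq> net_c j"
    "net_a i \<noteq> 1" "net_b i \<noteq> 1" "net_c i \<noteq> 1"
    "net_a i = net_a j \<longleftrightarrow> i = j" "net_b i = net_b j \<longleftrightarrow> i = j" "net_c i = net_c j \<longleftrightarrow> i = j"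
  by (rule less_5_cases[OF assms(1)]; rule less_5_cases[OF assms(2)]; simp)+

lemma combinatorially_simplicial_matroid_16_38: "combinatorially_simplicial matroid_16_38"
proof -
  have "(\<Sum>v\<in>points matroid_16_38. int (card v) - 3) = (\<Sum>k\<in>{1..38}. int (card (labelled_point k)) - 3)"
    using sum.reindex[OF inj_labelled_point, of "\<lambda>v. int (card v) - 3"]
    by (simp add: matroid_16_38_def)
  also have "{1..38::nat} = set [1, 2, 3, 4, 5, 6, 7, 8, 9, 10, 11, 12, 13, 14, 15, 16, 17, 18, 19, 20, 21, 22, 23,
      24, 25, 26, 27, 28, 29, 30, 31, 32, 33, 34, 35, 36, 37, 38]"
  proof -
    have "{1..38} = set [1..<39::nat]" by auto
    then show ?thesis by (simp add: upt_rec numeral_eq_Suc)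
  qed
  also have "(\<Sum>k\<in>\<dots>. int (card (labelled_point k)) - 3) = - 3"
    by (simp add: labelled_points)
  finally show ?thesis by (simp add: combinatorially_simplicial_def sigma_def)
qed

lemma double_points_on_line_1:
  assumes "v \<in> points matroid_16_38" "1 \<in> v" "v \<noteq> insert 1 (net_c ` {..<5})"
  shows "card v = 2"
proof -
  have v: "\<exists>k. 1 \<in> v \<and> k \<in> v \<and> k \<noteq> 1 \<and> k \<in> lines matroid_16_38"
  proof -
    have "v \<subset> lines matroid_16_38" "2 \<le> card v"
      using assms rank_three_matroid_16_38 by (auto simp: rank_three_matroid_def)
    then have "\<not> v \<subseteq> {1}" using card_mono[of "{1::nat}" v] by auto
    then show ?thesis using assms(2) \<open>v \<subset> lines matroid_16_38\<close> by auto
  qed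
  then obtain l where l: "l \<in> v" "l \<noteq> 1" "l \<in> lines matroid_16_38" by blast
  note eq = points_eq[OF rank_three_matroid_16_38 assms(1) _ assms(2) l(1) _ _ l(2)[symmetric]]
  from l(3) show ?thesis
  proof (cases rule: line_cases)
    case (a i)
    then show ?thesis using eq[OF point_one_a[of i]] net_neq(4)[of i i] by simp
  next
    case (b i)
    then show ?thesis using eq[OF point_one_b[of i]] net_neq(5)[of i i] by simp
  next
    case (c i)
    then show ?thesis using eq[OF point_c] assms(3) by simp
  qed (use l in simp)
qed

lemma generated_a:
  assumes "net_a 0 \<in> generated_lines matroid_16_38 H" "net_a 1 \<in> generated_lines matroid_16_38 H"
    and "net_c k \<in> generated_lines matroid_16_38 H" "net_b ((i + k) mod 5) \<in> generated_lines matroid_16_38 H"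
    and "i < 5" "k < 5"
  shows "net_a i \<in> generated_lines matroid_16_38 H"
proof (rule generated_lines.join[OF assms(1,2) _ point_a _ _ assms(3,4) _ point_triple[OF assms(5,6)]])
  have "net_c k \<notin> net_a ` {..<5}" using net_neq(2)[OF _ assms(6)] by (metis imageE lessThan_iff)
  then show "net_a ` {..<5} \<noteq> {net_a i, net_c k, net_b ((i + k) mod 5)}" by blast
qed (use assms(5,6) net_neq(3)[of "(i + k) mod 5" k] net_neq(7)[of 0 1]
    in \<open>auto simp del: net_simps\<close>)

lemma generated_b:
  assumes "net_b 0 \<in> generated_lines matroid_16_38 H" "net_b 1 \<in> generated_lines matroid_16_38 H"
    and "net_a i \<in> generated_lines matroid_16_38 H" "net_c k \<in> generated_lines matroid_16_38 H"
    and "i < 5" "k < 5"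
  shows "net_b ((i + k) mod 5) \<in> generated_lines matroid_16_38 H"
proof (rule generated_lines.join[OF assms(1,2) _ point_b _ _ assms(3,4) _ point_triple[OF assms(5,6)]])
  have "net_c k \<notin> net_b ` {..<5}" using net_neq(3)[OF _ assms(6)] by (metis imageE lessThan_iff)
  then show "net_b ` {..<5} \<noteq> {net_a i, net_c k, net_b ((i + k) mod 5)}" by blast
qed (use assms(5,6) net_neq(2)[of i k] net_neq(8)[of 0 1]
    in \<open>auto simp del: net_simps\<close>)

lemma generated_c:
  assumes "1 \<in> generated_lines matroid_16_38 H" "net_c 0 \<in> generated_lines matroid_16_38 H"
    and "net_a i \<in> generated_lines matroid_16_38 H" "net_b ((i + k) mod 5) \<in> generated_lines matroid_16_38 H"
    and "i < 5" "k < 5"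
  shows "net_c k \<in> generated_lines matroid_16_38 H"
proof (rule generated_lines.join[OF assms(1,2) _ point_c _ _ assms(3,4) _ point_triple[OF assms(5,6)]])
  have "net_a i \<notin> insert 1 (net_c ` {..<5})" using net_neq(2)[OF assms(5)] net_neq(4)[OF assms(5,5)] by auto
  then show "insert 1 (net_c ` {..<5}) \<noteq> {net_a i, net_c k, net_b ((i + k) mod 5)}" by blast
qed (use assms(5,6) net_neq(1)[of i "(i + k) mod 5"] net_neq(6)[of 0 0]
    in \<open>auto simp del: net_simps\<close>)

text \<open>Lines \<open>0\<close> and \<open>1\<close> of two classes determine line \<open>0\<close> of the third. Its intersection with line 1
  is the common point of the third class; from then on each triple point on two known lines gives
  its third line.\<close>

lemma generates_matroid_16_38:
  "generates matroid_16_38 [1, net_a 0, net_a 1, net_b 0, net_b 1]" (is "generates _ ?Hs")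
proof -
  let ?G = "generated_lines matroid_16_38 (set ?Hs)"
  have base: "1 \<in> ?G" "net_a 0 \<in> ?G" "net_a 1 \<in> ?G" "net_b 0 \<in> ?G" "net_b 1 \<in> ?G"
    by (auto intro: generated_lines.generator)
  have c0: "net_c 0 \<in> ?G"
    by (rule generated_lines.join[OF base(2,4) _ point_triple[of 0 0] _ _ base(3,5) _ point_triple[of 1 0]])
      (auto simp: insert_eq_iff doubleton_eq_iff)
  have c1: "net_c 1 \<in> ?G" by (rule generated_c[OF base(1) c0 base(2)]) (use base(5) in simp_all)
  have c4: "net_c 4 \<in> ?G" by (rule generated_c[OF base(1) c0 base(3)]) (use base(4) in simp_all)
  have b2: "net_b 2 \<in> ?G" using generated_b[OF base(4,5,3) c1] by (simp add: numeral_2_eq_2)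
  have a2: "net_a 2 \<in> ?G" by (rule generated_a[OF base(2,3) c4]) (use base(5) in simp_all)
  have c2: "net_c 2 \<in> ?G" by (rule generated_c[OF base(1) c0 base(2)]) (use b2 in simp_all)
  have c3: "net_c 3 \<in> ?G" by (rule generated_c[OF base(1) c0 a2]) (use base(4) in simp_all)
  have a3: "net_a 3 \<in> ?G" by (rule generated_a[OF base(2,3) c3]) (use base(5) in simp_all)
  have a4: "net_a 4 \<in> ?G" by (rule generated_a[OF base(2,3) c2]) (use base(5) in simp_all)
  have b3: "net_b 3 \<in> ?G" using generated_b[OF base(4,5,3) c2] by simp
  have b4: "net_b 4 \<in> ?G" using generated_b[OF base(4,5,3) c3] by simp
  have all: "net_a i \<in> ?G \<and> net_b i \<in> ?G \<and> net_c i \<in> ?G" if "i < 5" for i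
    using less_5_cases[OF that] base c0 c1 c2 c3 c4 a2 a3 a4 b2 b3 b4 by (metis One_nat_def)
  have "lines matroid_16_38 \<subseteq> ?G"
    using all base(1) by (auto elim: line_cases)
  then show ?thesis
    unfolding generates_iff[OF rank_three_matroid_16_38] by (simp add: lines_matroid)
qed

lemma generation_number_matroid_16_38: "generation_number matroid_16_38 = 5"
  unfolding generation_number_def
proof (rule Least_equality)
  show "\<exists>Hs. length Hs = 5 \<and> generates matroid_16_38 Hs"
    using generates_matroid_16_38 by (intro exI[of _ "[1, net_a 0, net_a 1, net_b 0, net_b 1]"]) simp
next
  fix n assume "\<exists>Hs. length Hs = n \<and> generates matroid_16_38 Hs"
  moreover have "length Hs > 4" if "generates matroid_16_38 Hs" for Hs
    by (rule four_generators_insufficient[OF rank_three_matroid_16_38 _ point_c _ double_points_on_line_1 that])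
      (simp_all add: lines_matroid)
  ultimately show "5 \<le> n" by fastforce
qed

section \<open>A normal form for the realizations\<close>

text \<open>The Ceva arrangement of the fifth roots of unity without its coordinate lines, together with
  one more line through a vertex of the coordinate triangle, whose slope is the parameter \<open>t\<close>.\<close>

definition normal_form :: "'k::field \<Rightarrow> 'k \<Rightarrow> nat \<Rightarrow> 'k ^ 3" where
  "normal_form \<zeta> t = (\<lambda>l\<in>{1..16}. vector
     ([[t, - 1, 0], [1, 0, - 1], [1, 0, - \<zeta>], [0, 1, - 1],
       [0, 1, - (\<zeta> ^ 3)], [1, 0, - (\<zeta> ^ 2)], [1, 0, - (\<zeta> ^ 3)], [1, 0, - (\<zeta> ^ 4)],
       [0, 1, - (\<zeta> ^ 4)], [0, 1, - \<zeta>], [0, 1, - (\<zeta> ^ 2)], [\<zeta> ^ 3, - 1, 0],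
       [1, - 1, 0], [\<zeta> ^ 4, - 1, 0], [\<zeta>, - 1, 0], [\<zeta> ^ 2, - 1, 0]] ! (l - 1)))"

lemma normal_form_simps:
  "normal_form \<zeta> t 1 = vector [t, - 1, 0]"
  "i < 5 \<Longrightarrow> normal_form \<zeta> t (net_a i) = vector [1, 0, - (\<zeta> ^ i)]"
  "i < 5 \<Longrightarrow> normal_form \<zeta> t (net_b i) = vector [0, 1, - (\<zeta> ^ i)]"
  "i < 5 \<Longrightarrow> normal_form \<zeta> t (net_c i) = vector [\<zeta> ^ i, - 1, 0]"
  by (simp add: normal_form_def) (erule less_5_cases; simp add: normal_form_def)+

lemma normal_form_in_matrices: "normal_form \<zeta> t \<in> matrices (lines matroid_16_38)"
  by (simp add: normal_form_def matrices_def lines_matroid)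

lemma bracket_vector:
  "bracket (vector [a1, a2, a3]) (vector [b1, b2, b3]) (vector [c1, c2, c3]) =
     a1 * (b2 * c3 - b3 * c2) - a2 * (b1 * c3 - b3 * c1) + a3 * (b1 * c2 - b2 * c1)"
  by (simp add: bracket_def)

text \<open>The fifth cyclotomic polynomial.\<close>

definition fifth_root_polynomial :: "'k::field \<Rightarrow> 'k" where
  "fifth_root_polynomial \<zeta> = 1 + \<zeta> + \<zeta> ^ 2 + \<zeta> ^ 3 + \<zeta> ^ 4"

lemma primitive_fifth_root:
  fixes \<zeta> :: "'k::field_char_0"
  assumes "fifth_root_polynomial \<zeta> = 0"
  shows "\<zeta> ^ 5 = 1" "\<zeta> \<noteq> 1" "\<zeta> \<noteq> 0"
    and "i < 5 \<Longrightarrow> j < 5 \<Longrightarrow> \<zeta> ^ i = \<zeta> ^ j \<longleftrightarrow> i = j"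
proof -
  have "\<zeta> ^ 5 - 1 = (\<zeta> - 1) * fifth_root_polynomial \<zeta>"
    by (simp add: fifth_root_polynomial_def algebra_simps power_numeral_reduce)
  then show p5: "\<zeta> ^ 5 = 1" using assms by simp
  show n1: "\<zeta> \<noteq> 1" using assms by (auto simp: fifth_root_polynomial_def)
  show n0: "\<zeta> \<noteq> 0" using p5 by auto
  have "\<zeta> ^ d \<noteq> 1" if d: "d \<in> {1, 2, 3, 4}" for d
  proof
    assume 1: "\<zeta> ^ d = 1"
    have ids: "\<zeta> * (\<zeta> ^ 2) ^ 2 = \<zeta> ^ 5" "\<zeta> * \<zeta> ^ 5 = (\<zeta> ^ 3) ^ 2" "\<zeta> * \<zeta> ^ 4 = \<zeta> ^ 5"
      by (simp_all add: power_numeral_reduce mult.assoc)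
    consider "\<zeta> = 1" | "\<zeta> ^ 2 = 1" | "\<zeta> ^ 3 = 1" | "\<zeta> ^ 4 = 1" using d 1 by auto
    then have "\<zeta> = 1" by cases (use ids p5 in \<open>metis mult_1_right power_one\<close>)+
    then show False using n1 by simp
  qed
  then have less: "\<zeta> ^ i \<noteq> \<zeta> ^ j" if "i < j" "j < 5" for i j
  proof -
    have "\<zeta> ^ j = \<zeta> ^ i * \<zeta> ^ (j - i)" using that by (simp flip: power_add)
    moreover have "j - i \<in> {1, 2, 3, 4}" using that by auto
    ultimately show ?thesis using \<open>\<And>d. d \<in> {1, 2, 3, 4} \<Longrightarrow> \<zeta> ^ d \<noteq> 1\<close> n0 by auto
  qed
  show "\<zeta> ^ i = \<zeta> ^ j \<longleftrightarrow> i = j" if "i < 5" "j < 5"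
    using less[of i j] less[of j i] that by (metis linorder_neqE_nat)
qed

lemma symmetric_triple_induct:
  fixes r :: "'a \<Rightarrow> nat"
  assumes "\<And>i j k. P i j k \<Longrightarrow> P j i k" "\<And>i j k. P i j k \<Longrightarrow> P j k i"
    and "r i \<le> r j \<Longrightarrow> r j \<le> r k \<Longrightarrow> P i j k" "r i \<le> r k \<Longrightarrow> r k \<le> r j \<Longrightarrow> P i k j"
    and "r j \<le> r i \<Longrightarrow> r i \<le> r k \<Longrightarrow> P j i k" "r j \<le> r k \<Longrightarrow> r k \<le> r i \<Longrightarrow> P j k i"
    and "r k \<le> r i \<Longrightarrow> r i \<le> r j \<Longrightarrow> P k i j" "r k \<le> r j \<Longrightarrow> r j \<le> r i \<Longrightarrow> P k j i"
  shows "P i j k"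
  using assms by (meson linear)

lemma concurrent_permute:
  "concurrent L j i k \<longleftrightarrow> concurrent L i j k" "concurrent L j k i \<longleftrightarrow> concurrent L i j k"
  by (auto simp: concurrent_def)

text \<open>With the vertices of the coordinate triangle as centres of three pencils, all brackets of lines
  from at most two pencils are decided by which pencils the lines belong to; only triples with one
  line from each pencil impose an equation.\<close>

lemma represents_three_pencils:
  fixes x :: "'l \<Rightarrow> 'k::field"
  assumes L: "rank_three_matroid L"
    and points: "A \<in> points L" "B \<in> points L" "C \<in> points L"
    and lines: "lines L \<subseteq> A \<union> B \<union> C" and disjoint: "A \<inter> B = {}" "A \<inter> C = {}" "B \<inter> C = {}"
    and N: "\<And>l. l \<in> A \<Longrightarrow> N l = vector [1, 0, - x l]" "\<And>l. l \<in> B \<Longrightarrow> N l = vector [0, 1, - x l]"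
      "\<And>l. l \<in> C \<Longrightarrow> N l = vector [x l, - 1, 0]"
    and inj: "inj_on x A" "inj_on x B" "inj_on x C" and nz: "\<And>l. l \<in> A \<union> B \<union> C \<Longrightarrow> x l \<noteq> 0"
    and mixed: "\<And>i j k. i \<in> A \<Longrightarrow> j \<in> B \<Longrightarrow> k \<in> C \<Longrightarrow> concurrent L i j k \<longleftrightarrow> x k * x i = x j"
  shows "represents L N"
proof -
  define r where "r l = (if l \<in> A then 0 else if l \<in> B then 1 else 2 :: nat)" for l
  let ?P = "\<lambda>i j k. bracket (N i) (N j) (N k) = 0 \<longleftrightarrow> concurrent L i j k"
  have perm: "?P j i k" "?P j k i" if "?P i j k" for i j k
    using that bracket_swap[of "N j" "N i" "N k"] bracket_rotate[of "N j" "N k" "N i"] concurrent_permute[of L]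
    by simp_all
  have pencil: "concurrent L i j k \<longleftrightarrow> k \<in> S" if "S \<in> {A, B, C}" "i \<in> S" "j \<in> S" "i \<noteq> j" for S i j k
    using concurrent_iff[OF L _ that(2-4)] that(1) points by auto
  have x_neq: "x i \<noteq> x j" if "S \<in> {A, B, C}" "i \<in> S" "j \<in> S" "i \<noteq> j" for S i j
    using that inj by (auto dest: inj_onD)
  have ordered: "?P i j k"
    if ijk: "i \<in> lines L" "j \<in> lines L" "k \<in> lines L" "i \<noteq> j" "i \<noteq> k" "j \<noteq> k"
      and r: "r i \<le> r j" "r j \<le> r k" for i j k
  proof -
    have cases: "l \<in> A \<and> r l = 0 \<or> l \<in> B \<and> r l = 1 \<or> l \<in> C \<and> r l = 2" if "l \<in> lines L" for l
      using that lines disjoint by (auto simp: r_def)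
    consider "i \<in> A" "j \<in> A" | "i \<in> A" "j \<in> B" "k \<in> B" | "i \<in> A" "j \<in> B" "k \<in> C"
      | "i \<in> A" "j \<in> C" "k \<in> C" | "i \<in> B" "j \<in> B" | "i \<in> B" "j \<in> C" "k \<in> C"
      | "i \<in> C" "j \<in> C" "k \<in> C"
      using cases[OF ijk(1)] cases[OF ijk(2)] cases[OF ijk(3)] r by (elim disjE conjE) simp_all
    then show ?thesis
    proof cases
      case 1
      have "k \<in> A \<or> k \<in> B \<or> k \<in> C" using ijk(3) lines by blast
      then show ?thesis
        using 1 disjoint x_neq[of A i j] ijk(4) by (auto simp: pencil[of A] N bracket_vector)
    next
      case 2
      then have "\<not> concurrent L i j k"
        using pencil[of B j k i] disjoint ijk(6) concurrent_permute[of L] by auto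
      then show ?thesis using 2 x_neq[of B j k] ijk(6) by (simp add: N bracket_vector)
    next
      case 3
      then show ?thesis by (simp add: N bracket_vector mixed mult.commute)
    next
      case 4
      then have "\<not> concurrent L i j k"
        using pencil[of C j k i] disjoint ijk(6) concurrent_permute[of L] by auto
      then show ?thesis using 4 x_neq[of C j k] nz[of i] ijk(6) by (simp add: N bracket_vector)
    next
      case 5
      have k: "k \<in> B \<or> k \<in> C" using cases[OF ijk(3)] cases[OF ijk(2)] 5 r disjoint by auto
      have "bracket (N i) (N j) (N k) = x k * (x i - x j)" if "k \<in> C"
        using 5 that by (simp add: N bracket_vector algebra_simps)
      then show ?thesis
        using 5 k disjoint x_neq[of B i j] nz[of k] ijk(4) by (auto simp: pencil[of B] N bracket_vector)
    next
      case 6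
      then have "\<not> concurrent L i j k"
        using pencil[of C j k i] disjoint ijk(6) concurrent_permute[of L] by auto
      then show ?thesis using 6 x_neq[of C j k] nz[of i] ijk(6) by (simp add: N bracket_vector)
    next
      case 7
      then show ?thesis using ijk(4) by (auto simp: pencil[of C] N bracket_vector)
    qed
  qed
  show ?thesis
    unfolding represents_def
  proof (intro ballI impI)
    fix i j k assume ijk: "i \<in> lines L" "j \<in> lines L" "k \<in> lines L" "i \<noteq> j \<and> i \<noteq> k \<and> j \<noteq> k"
    show "?P i j k"
      by (rule symmetric_triple_induct[where P = ?P and r = r, OF perm])
        (assumption | (rule ordered; (assumption | use ijk in blast)))+
  qed
qed

lemma represents_normal_form:
  fixes \<zeta> t :: "'k::field_char_0"
  assumes \<zeta>: "fifth_root_polynomial \<zeta> = 0" and t: "t \<noteq> 0" "t ^ 5 \<noteq> 1"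
  shows "represents matroid_16_38 (normal_form \<zeta> t)"
proof -
  let ?C = "insert 1 (net_c ` {..<5})"
  note root = primitive_fifth_root[OF \<zeta>]
  define x where "x l = (if l \<in> ?C then normal_form \<zeta> t l $ 1 else - normal_form \<zeta> t l $ 3)" for l
  have x: "x 1 = t" "i < 5 \<Longrightarrow> x (net_a i) = \<zeta> ^ i" "i < 5 \<Longrightarrow> x (net_b i) = \<zeta> ^ i"
    "i < 5 \<Longrightarrow> x (net_c i) = \<zeta> ^ i" for i
    using net_neq[of i] by (auto simp: x_def normal_form_simps simp del: One_nat_def)
  have t_power: "t * \<zeta> ^ i \<noteq> \<zeta> ^ j" for i j
  proof
    assume "t * \<zeta> ^ i = \<zeta> ^ j"
    then have "(t * \<zeta> ^ i) ^ 5 = (\<zeta> ^ j) ^ 5" by simp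
    moreover have "(\<zeta> ^ n) ^ 5 = 1" for n using root(1) by (metis power_mult mult.commute power_one)
    ultimately show False using t by (simp add: power_mult_distrib)
  qed
  have power_mod: "\<zeta> ^ (n mod 5) = \<zeta> ^ n" for n
    using root(1) by (metis mod_mult_div_eq mult.right_neutral power_add power_mult power_one)
  show ?thesis
  proof (rule represents_three_pencils[OF rank_three_matroid_16_38 point_a point_b point_c])
    show "lines matroid_16_38 \<subseteq> net_a ` {..<5} \<union> net_b ` {..<5} \<union> ?C"
      by (auto elim: line_cases)
    show "net_a ` {..<5} \<inter> net_b ` {..<5} = {}" "net_a ` {..<5} \<inter> ?C = {}" "net_b ` {..<5} \<inter> ?C = {}"
      by (simp_all add: net_images)
    show "inj_on x (net_a ` {..<5})" "inj_on x (net_b ` {..<5})"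
      by (auto simp: inj_on_def x root(4))
    show "inj_on x ?C"
      using t_power[of 0] by (auto simp: inj_on_def x root(4) simp del: One_nat_def)
    show "x l \<noteq> 0" if "l \<in> net_a ` {..<5} \<union> net_b ` {..<5} \<union> ?C" for l
      using that t root(3) by (auto simp: x simp del: One_nat_def)
    show "normal_form \<zeta> t l = vector [1, 0, - x l]" if "l \<in> net_a ` {..<5}" for l
      using that by (auto simp: x normal_form_simps)
    show "normal_form \<zeta> t l = vector [0, 1, - x l]" if "l \<in> net_b ` {..<5}" for l
      using that by (auto simp: x normal_form_simps)
    show "normal_form \<zeta> t l = vector [x l, - 1, 0]" if "l \<in> ?C" for l
      using that by (auto simp: x normal_form_simps simp del: One_nat_def)
    fix l m n assume "l \<in> net_a ` {..<5}" "m \<in> net_b ` {..<5}" and n: "n \<in> ?C"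
    then obtain i j where lm: "i < 5" "l = net_a i" "j < 5" "m = net_b j" by auto
    show "concurrent matroid_16_38 l m n \<longleftrightarrow> x n * x l = x m"
    proof (cases "n = 1")
      case True
      have "concurrent matroid_16_38 1 (net_a i) m \<longleftrightarrow> m \<in> {1, net_a i}"
        using lm net_neq(4)[of i i]
        by (intro concurrent_iff[OF rank_three_matroid_16_38 point_one_a]) auto
      then have "\<not> concurrent matroid_16_38 l m n"
        using lm True net_neq(1)[of i j] net_neq(5)[of j j] concurrent_permute(2) by fastforce
      then show ?thesis using True lm t_power by (simp add: x del: One_nat_def)
    next
      case False
      then obtain k where k: "k < 5" "n = net_c k" using n by auto
      have "concurrent matroid_16_38 (net_a i) (net_c k) m \<longleftrightarrow> m \<in> {net_a i, net_c k, net_b ((i + k) mod 5)}"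
        using lm k net_neq(2)[of i k]
        by (intro concurrent_iff[OF rank_three_matroid_16_38] point_triple) auto
      moreover have "m \<in> {net_a i, net_c k, net_b ((i + k) mod 5)} \<longleftrightarrow> j = (i + k) mod 5"
        using lm k net_neq(1)[of i j] net_neq(3)[of j k] net_neq(8)[of j "(i + k) mod 5"] by auto
      moreover have "x n * x l = x m \<longleftrightarrow> \<zeta> ^ ((i + k) mod 5) = \<zeta> ^ j"
        using lm k by (simp add: x power_mod power_add mult.commute)
      moreover have "concurrent matroid_16_38 (net_a i) (net_c k) m \<longleftrightarrow> concurrent matroid_16_38 l m n"
        using lm k by (auto simp: concurrent_def)
      ultimately show ?thesis using root(4)[of "(i + k) mod 5" j] lm(3) by auto
    qed
  qed
qed

lemma proj_equiv_mult: "invertible G \<Longrightarrow> proj_equiv L M (\<lambda>l. G *v M l)"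
  unfolding proj_equiv_def by (intro exI[of _ G] exI[of _ "\<lambda>_. 1"]) simp

lemma proj_equiv_scale:
  assumes "\<And>l. l \<in> lines L \<Longrightarrow> \<exists>c. c \<noteq> 0 \<and> N l = c *s M l"
  shows "proj_equiv L M N"
proof -
  obtain c where "\<And>l. l \<in> lines L \<Longrightarrow> c l \<noteq> 0 \<and> N l = c l *s M l" using assms by metis
  then show ?thesis
    unfolding proj_equiv_def by (intro exI[of _ "mat 1"] exI[of _ c]) (simp add: invertible_def)
qed

lemma net_brackets:
  assumes M: "represents matroid_16_38 M"
  shows "i < 5 \<Longrightarrow> bracket (M (net_a 0)) (M (net_a 1)) (M (net_a i)) = 0"
    "i < 5 \<Longrightarrow> bracket (M (net_b 0)) (M (net_b 1)) (M (net_b i)) = 0"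
    "bracket (M (net_c 0)) (M (net_c 1)) (M 1) = 0"
    "i < 5 \<Longrightarrow> k < 5 \<Longrightarrow> bracket (M (net_a i)) (M (net_b ((i + k) mod 5))) (M (net_c k)) = 0"
    "l \<in> lines matroid_16_38 \<Longrightarrow> l \<notin> net_a ` {..<5} \<Longrightarrow>
       bracket (M (net_a 0)) (M (net_a 1)) (M l) \<noteq> 0"
    "l \<in> lines matroid_16_38 \<Longrightarrow> l \<notin> net_b ` {..<5} \<Longrightarrow>
       bracket (M (net_b 0)) (M (net_b 1)) (M l) \<noteq> 0"
proof -
  let ?L = matroid_16_38
  have ends: "net_a 0 \<in> net_a ` {..<5}" "net_a 1 \<in> net_a ` {..<5}"
    "net_b 0 \<in> net_b ` {..<5}" "net_b 1 \<in> net_b ` {..<5}"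
    by (auto simp del: net_simps One_nat_def)
  have A: "concurrent ?L (net_a 0) (net_a 1) l \<longleftrightarrow> l \<in> net_a ` {..<5}" for l
    using ends net_neq(7)[of 0 1] by (intro concurrent_iff[OF rank_three_matroid_16_38 point_a]) auto
  have B: "concurrent ?L (net_b 0) (net_b 1) l \<longleftrightarrow> l \<in> net_b ` {..<5}" for l
    using ends net_neq(8)[of 0 1] by (intro concurrent_iff[OF rank_three_matroid_16_38 point_b]) auto
  have zero: "bracket (M i) (M j) (M k) = 0"
    if "concurrent ?L i j k" "i \<in> lines ?L" "j \<in> lines ?L" "k \<in> lines ?L" for i j k
    using that representsD[OF M that(2-4)] by (cases "i = j \<or> i = k \<or> j = k") auto
  have nonzero: "bracket (M i) (M j) (M k) \<noteq> 0"
    if "\<not> concurrent ?L i j k" "i \<in> lines ?L" "j \<in> lines ?L" "k \<in> lines ?L" "i \<noteq> j" "i \<noteq> k" "j \<noteq> k"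
    for i j k
    using that representsD[OF M that(2-7)] by simp
  have one: "1 \<in> lines ?L" by (simp add: lines_matroid)
  note L = net_in_lines[of 0] net_in_lines[of 1] one
  show "bracket (M (net_a 0)) (M (net_a 1)) (M (net_a i)) = 0" if "i < 5"
    using that by (intro zero L net_in_lines) (auto simp: A simp del: net_simps One_nat_def)
  show "bracket (M (net_b 0)) (M (net_b 1)) (M (net_b i)) = 0" if "i < 5"
    using that by (intro zero L net_in_lines) (auto simp: B simp del: net_simps One_nat_def)
  show "bracket (M (net_c 0)) (M (net_c 1)) (M 1) = 0"
    by (intro zero L net_in_lines)
      (auto simp: concurrent_def simp del: net_simps One_nat_def intro!: bexI[OF _ point_c])
  show "bracket (M (net_a i)) (M (net_b ((i + k) mod 5))) (M (net_c k)) = 0" if "i < 5" "k < 5"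
    using that by (intro zero net_in_lines) (auto simp: concurrent_def intro!: bexI[OF _ point_triple[OF that]])
  show "bracket (M (net_a 0)) (M (net_a 1)) (M l) \<noteq> 0"
    if "l \<in> lines ?L" "l \<notin> net_a ` {..<5}"
    using that ends net_neq(7)[of 0 1] by (intro nonzero L) (auto simp: A simp del: net_simps One_nat_def)
  show "bracket (M (net_b 0)) (M (net_b 1)) (M l) \<noteq> 0"
    if "l \<in> lines ?L" "l \<notin> net_b ` {..<5}"
    using that ends net_neq(8)[of 0 1] by (intro nonzero L) (auto simp: B simp del: net_simps One_nat_def)
qed

text \<open>For each \<open>k\<close> the \<open>k\<close>-th line of the third class is the graph of an affine map taking \<open>\<alpha> i\<close> to
  \<open>\<beta> (i + k)\<close>. The quotient of two consecutive maps permutes the five values \<open>\<alpha> i\<close> cyclically, so its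
  linear part \<open>\<zeta>\<close> is a root of the cyclotomic polynomial. The choice of origin and unit makes \<open>\<beta> = \<alpha>\<close>.\<close>

lemma affine_five_cycle:
  fixes \<alpha> \<beta> s r :: "nat \<Rightarrow> 'k::field"
  assumes rel: "\<And>i k. i < 5 \<Longrightarrow> k < 5 \<Longrightarrow> \<beta> ((i + k) mod 5) = s k * \<alpha> i + r k"
    and start: "\<alpha> 0 = 0" "\<alpha> 1 = 1" "\<beta> 0 = 0" "\<beta> 1 = 1"
  obtains \<zeta> where "fifth_root_polynomial \<zeta> = 0"
    "\<And>i. i < 5 \<Longrightarrow> (1 - \<zeta>) * \<alpha> i = 1 - \<zeta> ^ i" "\<And>i. i < 5 \<Longrightarrow> (1 - \<zeta>) * \<beta> i = 1 - \<zeta> ^ i"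
    "\<And>i. i < 5 \<Longrightarrow> s i = \<zeta> ^ i" "\<And>i. i < 5 \<Longrightarrow> (1 - \<zeta>) * r i = 1 - \<zeta> ^ i"
proof -
  define \<zeta> where "\<zeta> = \<alpha> 2 - 1"
  have r: "r i = \<beta> i" if "i < 5" for i using rel[of 0 i] start that by simp
  have s0: "s 0 = 1" using rel[of 1 0] r[of 0] start by simp
  have ab: "\<beta> i = \<alpha> i" if "i < 5" for i using rel[of i 0] s0 r[of 0] start that by simp
  have a2: "\<alpha> 2 = \<zeta> + 1" by (simp add: \<zeta>_def)
  have s: "s i = \<beta> ((i + 1) mod 5) - \<beta> i" if "i < 5" for i
    using rel[of 1 i] r[of i] start that by (simp add: add.commute)
  have s1: "s 1 = \<zeta>" using s[of 1] a2 ab[of 2] start by (simp add: numeral_2_eq_2)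
  have a3: "\<alpha> 3 = \<zeta> * \<alpha> 2 + 1" using rel[of 2 1] s1 r[of 1] ab[of 3] start by simp
  have a4: "\<alpha> 4 = \<zeta> * \<alpha> 3 + 1" using rel[of 3 1] s1 r[of 1] ab[of 4] start by simp
  have a5: "0 = \<zeta> * \<alpha> 4 + 1" using rel[of 4 1] s1 r[of 1] start by simp
  have poly: "fifth_root_polynomial \<zeta> = 0"
    using a5 unfolding a4 a3 a2 by (simp add: fifth_root_polynomial_def algebra_simps power_numeral_reduce)
  have a: "(1 - \<zeta>) * \<alpha> i = 1 - \<zeta> ^ i" if "i < 5" for i
    using that by (rule less_5_cases)
      (simp_all add: start[simplified] a2 a3 a4 algebra_simps power_numeral_reduce)
  have s_power: "s i = \<zeta> ^ i" if "i < 5" for i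
    using that
  proof (rule less_5_cases)
    assume "i = 4"
    have "\<zeta> ^ 4 = - \<alpha> 4"
      using poly unfolding a4 a3 a2
      by (simp add: fifth_root_polynomial_def algebra_simps power_numeral_reduce eq_neg_iff_add_eq_0)
    then show ?thesis using s[of 4] ab[of 4] start \<open>i = 4\<close> by simp
  next
    assume "i = 2"
    then show ?thesis
      using s[of 2] ab[of 2] ab[of 3] a2 a3 by (simp add: algebra_simps power2_eq_square)
  next
    assume "i = 3"
    then show ?thesis
      using s[of 3] ab[of 3] ab[of 4] a2 a3 a4 by (simp add: algebra_simps power_numeral_reduce)
  qed (use s0 s1 in simp_all)
  show ?thesis
    by (rule that[OF poly a _ s_power]) (use a ab r in simp_all)
qed

text \<open>Characteristic zero enters through \<open>\<zeta> \<noteq> 1\<close>: the affine map of order five is not a translation,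
  hence has a fixed point, which serves as origin. In characteristic five translations do occur.\<close>

lemma normal_form_exists:
  fixes M :: "nat \<Rightarrow> 'k::field_char_0 ^ 3"
  assumes M: "represents matroid_16_38 M"
  obtains \<zeta> t where "fifth_root_polynomial \<zeta> = 0" "proj_equiv matroid_16_38 M (normal_form \<zeta> t)"
proof -
  let ?L = matroid_16_38
  have a_notin: "net_a i \<notin> net_b ` {..<5}" if "i < 5" for i using that net_neq(1) by auto
  have b_notin: "net_b i \<notin> net_a ` {..<5}" if "i < 5" for i
    using net_neq(1)[OF _ that] by (metis imageE lessThan_iff)
  have c_notin: "net_c i \<notin> net_a ` {..<5}" if "i < 5" for i
    using net_neq(2)[OF _ that] by (metis imageE lessThan_iff)
  have one_notin: "1 \<notin> net_a ` {..<5}" by (simp add: net_images)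
  have one: "1 \<in> lines ?L" by (simp add: lines_matroid)
  \<comment> \<open>Affine coordinates in which the lines 0 and 1 of the first two pencils are the coordinate
    lines and their translates by 1.\<close>
  define A0 A1 B0 B1 where "A0 = M (net_a 0)" and "A1 = M (net_a 1)" and "B0 = M (net_b 0)" and "B1 = M (net_b 1)"
  have nz: "bracket A0 A1 B0 \<noteq> 0" "bracket A0 A1 B1 \<noteq> 0" "bracket B0 B1 A0 \<noteq> 0" "bracket B0 B1 A1 \<noteq> 0"
    unfolding A0_def A1_def B0_def B1_def
    by (intro net_brackets[OF M] net_in_lines a_notin b_notin; simp)+
  define g1 g2 g3 where "g1 = bracket B0 B1 A1 *s A0" and "g2 = - bracket A0 A1 B1 *s B0"
    and "g3 = g1 - bracket B0 B1 A0 *s A1"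
  have g3: "g3 = g2 + bracket A0 A1 B0 *s B1"
    by (simp add: g1_def g2_def g3_def vec_eq_iff forall_3 bracket_def algebra_simps)
  have "bracket g1 g2 g3 = - bracket B0 B1 A1 * bracket A0 A1 B1 * bracket B0 B1 A0 * bracket A0 A1 B0"
  proof -
    have "bracket (x *s A0) (y *s B0) (x *s A0 - z *s A1) = x * y * z * bracket A0 A1 B0" for x y z
      by (simp add: bracket_def algebra_simps)
    from this[of "bracket B0 B1 A1" "- bracket A0 A1 B1" "bracket B0 B1 A0"] show ?thesis
      unfolding g3_def g1_def g2_def by (simp only: mult_minus_left mult_minus_right)
  qed
  then have "bracket g1 g2 g3 \<noteq> 0" using nz by simp
  then obtain G :: "'k ^ 3 ^ 3" where G: "invertible G"
    "\<And>x y z. G *v (x *s g1 + y *s g2 + z *s g3) = vector [x, y, z]"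
    by (rule coordinates_wrt_basis) blast
  define p where "p l = G *v M l" for l
  have p: "represents ?L p" "proj_equiv ?L M p"
    using represents_proj_equiv[OF proj_equiv_mult M] proj_equiv_mult[of G ?L M] G(1)
    unfolding p_def by simp_all
  have pa0: "p (net_a 0) = inverse (bracket B0 B1 A1) *s vector [1, 0, 0]"
  proof -
    have "M (net_a 0) = inverse (bracket B0 B1 A1) *s (1 *s g1 + 0 *s g2 + 0 *s g3)"
      using nz by (simp add: g1_def A0_def vector_smult_assoc)
    then show ?thesis unfolding p_def by (simp only: vector_scalar_commute G(2))
  qed
  have pa1: "p (net_a 1) = inverse (bracket B0 B1 A0) *s vector [1, 0, - 1]"
  proof -
    have "M (net_a 1) = inverse (bracket B0 B1 A0) *s (1 *s g1 + 0 *s g2 + (- 1) *s g3)"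
      using nz by (simp add: g3_def A1_def vector_smult_assoc)
    then show ?thesis unfolding p_def by (simp only: vector_scalar_commute G(2))
  qed
  have pb0: "p (net_b 0) = inverse (- bracket A0 A1 B1) *s vector [0, 1, 0]"
  proof -
    have "M (net_b 0) = inverse (- bracket A0 A1 B1) *s (0 *s g1 + 1 *s g2 + 0 *s g3)"
      using nz by (simp add: g2_def B0_def vector_smult_assoc)
    then show ?thesis unfolding p_def by (simp only: vector_scalar_commute G(2))
  qed
  have pb1: "p (net_b 1) = inverse (- bracket A0 A1 B0) *s vector [0, 1, - 1]"
  proof -
    have "M (net_b 1) = inverse (- bracket A0 A1 B0) *s (0 *s g1 + 1 *s g2 + (- 1) *s g3)"
      using nz by (simp add: g3 B1_def vector_smult_assoc)
    then show ?thesis unfolding p_def by (simp only: vector_scalar_commute G(2))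
  qed
  have "bracket (x *s vector [1, 0, 0]) (y *s vector [1, 0, - 1]) v = x * y * v $ 2"
    "bracket (x *s vector [0, 1, 0]) (y *s vector [0, 1, - 1]) v = - (x * y * v $ 1)" for x y and v :: "'k ^ 3"
    by (simp_all add: bracket_def)
  note unit_brackets = this
  have bracket_aa: "bracket (p (net_a 0)) (p (net_a 1)) v = 0 \<longleftrightarrow> v $ 2 = 0"
    and bracket_bb: "bracket (p (net_b 0)) (p (net_b 1)) v = 0 \<longleftrightarrow> v $ 1 = 0" for v
    using nz unfolding pa0 pa1 pb0 pb1 unit_brackets by simp_all
  define \<alpha> \<beta> s r where "\<alpha> i = - p (net_a i) $ 3 / p (net_a i) $ 1"
    and "\<beta> i = - p (net_b i) $ 3 / p (net_b i) $ 2"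
    and "s i = - p (net_c i) $ 1 / p (net_c i) $ 2" and "r i = - p (net_c i) $ 3 / p (net_c i) $ 2" for i
  have a: "p (net_a i) $ 2 = 0" "p (net_a i) $ 1 \<noteq> 0" if "i < 5" for i
    using net_brackets(1)[OF p(1) that] net_brackets(6)[OF p(1) net_in_lines(1)[OF that] a_notin[OF that]]
    by (simp_all only: bracket_aa bracket_bb simp_thms)
  have b: "p (net_b i) $ 1 = 0" "p (net_b i) $ 2 \<noteq> 0" if "i < 5" for i
    using net_brackets(2)[OF p(1) that] net_brackets(5)[OF p(1) net_in_lines(2)[OF that] b_notin[OF that]]
    by (simp_all only: bracket_aa bracket_bb simp_thms)
  have c: "p (net_c i) $ 2 \<noteq> 0" if "i < 5" for i
    using net_brackets(5)[OF p(1) net_in_lines(3)[OF that] c_notin[OF that]]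
    by (simp only: bracket_aa simp_thms)
  have one2: "p 1 $ 2 \<noteq> 0" using net_brackets(5)[OF p(1) one one_notin] by (simp only: bracket_aa simp_thms)
  have rel: "\<beta> ((i + k) mod 5) = s k * \<alpha> i + r k" if "i < 5" "k < 5" for i k
  proof -
    let ?a = "p (net_a i)" and ?b = "p (net_b ((i + k) mod 5))" and ?c = "p (net_c k)"
    have "bracket ?a ?b ?c = ?a $ 1 * (?b $ 2 * ?c $ 3 - ?b $ 3 * ?c $ 2) - ?a $ 3 * ?b $ 2 * ?c $ 1"
      using a(1)[OF that(1)] b(1)[of "(i + k) mod 5"] by (simp add: bracket_def)
    then have "?a $ 1 * (?b $ 2 * ?c $ 3 - ?b $ 3 * ?c $ 2) = ?a $ 3 * ?b $ 2 * ?c $ 1"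
      using net_brackets(4)[OF p(1) that] by simp
    then show ?thesis
      using a(2)[OF that(1)] b(2)[of "(i + k) mod 5"] c[OF that(2)]
      unfolding \<alpha>_def \<beta>_def s_def r_def by (simp add: field_simps)
  qed
  have start: "\<alpha> 0 = 0" "\<alpha> 1 = 1" "\<beta> 0 = 0" "\<beta> 1 = 1"
    using nz unfolding \<alpha>_def \<beta>_def pa0 pa1 pb0 pb1 by simp_all
  obtain \<zeta> where \<zeta>: "fifth_root_polynomial \<zeta> = 0"
    and \<alpha>: "\<And>i. i < 5 \<Longrightarrow> (1 - \<zeta>) * \<alpha> i = 1 - \<zeta> ^ i" and \<beta>: "\<And>i. i < 5 \<Longrightarrow> (1 - \<zeta>) * \<beta> i = 1 - \<zeta> ^ i"
    and s: "\<And>i. i < 5 \<Longrightarrow> s i = \<zeta> ^ i" and r: "\<And>i. i < 5 \<Longrightarrow> (1 - \<zeta>) * r i = 1 - \<zeta> ^ i"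
    using affine_five_cycle[of \<beta> s \<alpha> r] rel start by blast
  note root = primitive_fifth_root[OF \<zeta>]
  \<comment> \<open>The affine map cycling the lines of a pencil has a fixed point, as \<open>\<zeta> \<noteq> 1\<close>; it becomes the origin.\<close>
  define f1 f2 f3 :: "'k ^ 3"
    where "f1 = vector [1 - \<zeta>, 0, - 1]" and "f2 = vector [0, 1 - \<zeta>, - 1]" and "f3 = vector [0, 0, - 1]"
  have "bracket f1 f2 f3 = - ((1 - \<zeta>) * (1 - \<zeta>))" by (simp add: f1_def f2_def f3_def bracket_vector algebra_simps)
  then have "bracket f1 f2 f3 \<noteq> 0" using root(2) by simp
  then obtain F :: "'k ^ 3 ^ 3" where F: "invertible F"
    "\<And>x y z. F *v (x *s f1 + y *s f2 + z *s f3) = vector [x, y, z]"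
    by (rule coordinates_wrt_basis) blast
  define q where "q l = F *v p l" for l
  have q: "represents ?L q" "proj_equiv ?L p q"
    using represents_proj_equiv[OF proj_equiv_mult p(1)] proj_equiv_mult[of F ?L p] F(1)
    unfolding q_def by simp_all
  have scaled: "\<exists>c. c \<noteq> 0 \<and> vector [x, y, z] = c *s q l"
    if "d \<noteq> 0" "d *s p l = x *s f1 + y *s f2 + z *s f3" for d x y z l
    using F(2)[of x y z] that unfolding q_def by (metis vector_scalar_commute)
  have qa: "\<exists>c. c \<noteq> 0 \<and> normal_form \<zeta> t (net_a i) = c *s q (net_a i)" if "i < 5" for i t
  proof -
    have "((1 - \<zeta>) / p (net_a i) $ 1) *s p (net_a i) = vector [1 - \<zeta>, 0, - ((1 - \<zeta>) * \<alpha> i)]"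
      using a[OF that] by (simp add: \<alpha>_def vec_eq_iff forall_3)
    also have "\<dots> = 1 *s f1 + 0 *s f2 + (- (\<zeta> ^ i)) *s f3"
      by (simp add: \<alpha>[OF that] f1_def f2_def f3_def vec_eq_iff forall_3)
    finally show ?thesis
      using scaled[of "(1 - \<zeta>) / p (net_a i) $ 1"] a[OF that] root(2) by (simp add: normal_form_simps that)
  qed
  have qb: "\<exists>c. c \<noteq> 0 \<and> normal_form \<zeta> t (net_b i) = c *s q (net_b i)" if "i < 5" for i t
  proof -
    have "((1 - \<zeta>) / p (net_b i) $ 2) *s p (net_b i) = vector [0, 1 - \<zeta>, - ((1 - \<zeta>) * \<beta> i)]"
      using b[OF that] by (simp add: \<beta>_def vec_eq_iff forall_3)
    also have "\<dots> = 0 *s f1 + 1 *s f2 + (- (\<zeta> ^ i)) *s f3"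
      by (simp add: \<beta>[OF that] f1_def f2_def f3_def vec_eq_iff forall_3)
    finally show ?thesis
      using scaled[of "(1 - \<zeta>) / p (net_b i) $ 2"] b[OF that] root(2) by (simp add: normal_form_simps that)
  qed
  have qc: "\<exists>c. c \<noteq> 0 \<and> normal_form \<zeta> t (net_c i) = c *s q (net_c i)" if "i < 5" for i t
  proof -
    have "(- (1 - \<zeta>) / p (net_c i) $ 2) *s p (net_c i) = vector [(1 - \<zeta>) * s i, - (1 - \<zeta>), (1 - \<zeta>) * r i]"
      using c[OF that] by (simp add: s_def r_def vec_eq_iff forall_3 field_simps)
    also have "\<dots> = (\<zeta> ^ i) *s f1 + (- 1) *s f2 + 0 *s f3"
      by (simp add: s[OF that] r[OF that] f1_def f2_def f3_def vec_eq_iff forall_3)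
    finally show ?thesis
      using scaled[of "- (1 - \<zeta>) / p (net_c i) $ 2"] c[OF that] root(2) by (simp add: normal_form_simps that)
  qed
  \<comment> \<open>Line 1 passes through the common point of the third pencil.\<close>
  obtain t where t: "\<exists>c. c \<noteq> 0 \<and> normal_form \<zeta> t 1 = c *s q 1"
  proof -
    obtain c0 c1 where c: "c0 \<noteq> 0" "normal_form \<zeta> 1 (net_c 0) = c0 *s q (net_c 0)"
      "c1 \<noteq> 0" "normal_form \<zeta> 1 (net_c 1) = c1 *s q (net_c 1)"
      using qc[of 0 1] qc[of 1 1] by auto
    have "c0 *s q (net_c 0) = vector [1, - 1, 0]" "c1 *s q (net_c 1) = vector [\<zeta>, - 1, 0]"
      using c normal_form_simps(4)[of 0 \<zeta> 1] normal_form_simps(4)[of 1 \<zeta> 1] by simp_all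
    from bracket_scale[of c0 "q (net_c 0)" c1 "q (net_c 1)" 1 "q 1", unfolded this]
    have "bracket (vector [1, - 1, 0]) (vector [\<zeta>, - 1, 0]) (q 1) =
        c0 * c1 * bracket (q (net_c 0)) (q (net_c 1)) (q 1)" by (simp only: vector_smult_lid mult_1_right)
    then have "bracket (vector [1, - 1, 0]) (vector [\<zeta>, - 1, 0]) (q 1) = 0"
      using net_brackets(3)[OF q(1)] by (simp only: mult_zero_right)
    then have q3: "q 1 $ 3 = 0" using root(2) by (simp add: bracket_def)
    obtain a0 a1 where a: "a0 \<noteq> 0" "normal_form \<zeta> 1 (net_a 0) = a0 *s q (net_a 0)"
      "a1 \<noteq> 0" "normal_form \<zeta> 1 (net_a 1) = a1 *s q (net_a 1)"
      using qa[of 0 1] qa[of 1 1] by auto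
    have "a0 *s q (net_a 0) = vector [1, 0, - 1]" "a1 *s q (net_a 1) = vector [1, 0, - \<zeta>]"
      using a normal_form_simps(2)[of 0 \<zeta> 1] normal_form_simps(2)[of 1 \<zeta> 1] by simp_all
    from bracket_scale[of a0 "q (net_a 0)" a1 "q (net_a 1)" 1 "q 1", unfolded this]
    have "bracket (vector [1, 0, - 1]) (vector [1, 0, - \<zeta>]) (q 1) =
        a0 * a1 * bracket (q (net_a 0)) (q (net_a 1)) (q 1)" by (simp only: vector_smult_lid mult_1_right)
    then have "bracket (vector [1, 0, - 1]) (vector [1, 0, - \<zeta>]) (q 1) \<noteq> 0"
      using net_brackets(5)[OF q(1) one one_notin] a by (simp only: mult_eq_0_iff simp_thms)
    then have q2: "q 1 $ 2 \<noteq> 0" by (auto simp: bracket_def)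
    have "normal_form \<zeta> (- q 1 $ 1 / q 1 $ 2) 1 = (- 1 / q 1 $ 2) *s q 1"
      using q2 q3 unfolding normal_form_simps(1) by (simp add: vec_eq_iff forall_3)
    then show ?thesis using that q2 by (metis div_0 divide_eq_0_iff neg_equal_0_iff_equal one_neq_zero)
  qed
  have "proj_equiv ?L q (normal_form \<zeta> t)"
    by (rule proj_equiv_scale, erule line_cases) (use qa qb qc t in auto)
  then show ?thesis using that[OF \<zeta>] proj_equiv_trans p(2) q(2) by metis
qed

section \<open>The moduli space over the complex numbers\<close>

text \<open>The cross-ratio of the lines \<open>a\<close> and \<open>b\<close> with respect to the points \<open>p \<inter> q\<close> and \<open>r \<inter> s\<close>. Each
  line occurs equally often above and below, which makes the ratio projectively invariant.\<close>

definition bracket_ratio :: "('l \<Rightarrow> 'k::field ^ 3) \<Rightarrow> 'l \<Rightarrow> 'l \<Rightarrow> 'l \<Rightarrow> 'l \<Rightarrow> 'l \<Rightarrow> 'l \<Rightarrow> 'k" where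
  "bracket_ratio M a b p q r s =
     (bracket (M a) (M p) (M q) * bracket (M b) (M r) (M s)) /
     (bracket (M b) (M p) (M q) * bracket (M a) (M r) (M s))"

lemma bracket_ratio_proj_equiv:
  assumes "proj_equiv L M N" "{a, b, p, q, r, s} \<subseteq> lines L"
  shows "bracket_ratio N a b p q r s = bracket_ratio M a b p q r s"
proof -
  obtain \<delta> c where d: "\<delta> \<noteq> 0" "\<And>i. i \<in> lines L \<Longrightarrow> c i \<noteq> 0"
    "\<And>i j k. i \<in> lines L \<Longrightarrow> j \<in> lines L \<Longrightarrow> k \<in> lines L \<Longrightarrow>
       bracket (N i) (N j) (N k) = \<delta> * c i * c j * c k * bracket (M i) (M j) (M k)"
    using bracket_proj_equiv[OF assms(1)] by blast
  define e where "e = \<delta> * \<delta> * c a * c b * c p * c q * c r * c s"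
  have "e \<noteq> 0" using d(1,2) assms(2) by (simp add: e_def)
  moreover have
    "bracket (N a) (N p) (N q) * bracket (N b) (N r) (N s) =
       e * (bracket (M a) (M p) (M q) * bracket (M b) (M r) (M s))"
    "bracket (N b) (N p) (N q) * bracket (N a) (N r) (N s) =
       e * (bracket (M b) (M p) (M q) * bracket (M a) (M r) (M s))"
    using d(3) assms(2) by (simp_all add: e_def mult.commute mult.left_commute)
  ultimately show ?thesis by (simp add: bracket_ratio_def)
qed

lemma polynomial_map_diff:
  assumes "polynomial_map E f" "polynomial_map E g"
  shows "polynomial_map E (\<lambda>M. f M - g M)"
  using polynomial_map.add[OF assms(1) polynomial_map.mult[OF polynomial_map.const[of E "- 1"] assms(2)]]
  by simp

lemma polynomial_map_bracket:
  "i \<in> E \<Longrightarrow> j \<in> E \<Longrightarrow> k \<in> E \<Longrightarrow> polynomial_map E (\<lambda>M. bracket (M i) (M j) (M k))"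
  unfolding bracket_def
  by (intro polynomial_map.intros polynomial_map_diff)

text \<open>The denominator does not vanish on realizations, so a level set is cut out by one polynomial.\<close>

lemma closedin_level_set_of_bracket_ratio:
  fixes \<kappa> :: "'k::field"
  assumes L: "rank_three_matroid L" and lines: "{a, b, p, q, r, s} \<subseteq> lines L"
    and nc: "\<not> concurrent L b p q" "\<not> concurrent L a r s" "distinct [b, p, q]" "distinct [a, r, s]"
  shows "closedin (moduli_topology L)
    (moduli_class L ` {M \<in> realizations L. bracket_ratio M a b p q r s = \<kappa>})" (is "closedin _ ?Z")
proof -
  let ?f = "\<lambda>M :: 'a \<Rightarrow> 'k ^ 3. bracket (M a) (M p) (M q) * bracket (M b) (M r) (M s) -
    \<kappa> * (bracket (M b) (M p) (M q) * bracket (M a) (M r) (M s))"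
  have "polynomial_map (lines L) ?f"
    using lines by (intro polynomial_map.intros polynomial_map_diff polynomial_map_bracket) auto
  moreover have "moduli_class L M \<in> ?Z \<longleftrightarrow> ?f M = 0" if M: "M \<in> realizations L" for M
  proof -
    have "represents L M" using M realizations_iff[OF L] by blast
    then have "bracket (M b) (M p) (M q) \<noteq> 0" "bracket (M a) (M r) (M s) \<noteq> 0"
      using representsD[of L M b p q] representsD[of L M a r s] nc lines by auto
    then have "?f M = 0 \<longleftrightarrow> bracket_ratio M a b p q r s = \<kappa>"
      by (simp add: bracket_ratio_def divide_eq_eq)
    moreover have "moduli_class L M \<in> ?Z \<longleftrightarrow> bracket_ratio M a b p q r s = \<kappa>"
    proof
      assume "moduli_class L M \<in> ?Z"
      then obtain M' where M': "M' \<in> realizations L" "bracket_ratio M' a b p q r s = \<kappa>"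
        "moduli_class L M = moduli_class L M'" by auto
      then have "proj_equiv L M' M" using moduli_class_eq_iff[OF L M'(1) M] by simp
      then show "bracket_ratio M a b p q r s = \<kappa>" using bracket_ratio_proj_equiv lines M'(2) by metis
    qed (use M in auto)
    ultimately show ?thesis by simp
  qed
  then have "{M \<in> realizations L. moduli_class L M \<in> ?Z} =
      realizations L \<inter> zero_locus (lines L) {?f}"
    by (auto simp: zero_locus_def realizations_def)
  ultimately show ?thesis
    unfolding closedin_moduli_topology moduli_space_eq by (intro conjI exI[of _ "{?f}"]) auto
qed

lemma polynomial_map_on_polynomial_curve:
  assumes "polynomial_map E f" "\<And>i j. i \<in> E \<Longrightarrow> \<exists>P. \<forall>t. \<gamma> t i $ j = poly P t"
  shows "\<exists>P. \<forall>t. f (\<gamma> t) = poly P t"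
  using assms(1)
proof induction
  case (const c)
  show ?case by (rule exI[of _ "[:c:]"]) simp
next
  case (coord i j)
  then show ?case using assms(2) by simp
next
  case (add f g)
  then show ?case by (metis poly_add)
next
  case (mult f g)
  then show ?case by (metis poly_mult)
qed

lemma normal_form_polynomial_curve:
  assumes "l \<in> lines matroid_16_38"
  shows "\<exists>P. \<forall>t. normal_form \<zeta> t l $ j = poly P t"
proof (cases "l = 1")
  case True
  have "\<forall>t. normal_form \<zeta> t 1 $ 1 = poly [:0, 1:] t" "\<forall>t. normal_form \<zeta> t 1 $ 2 = poly [:- 1:] t"
    "\<forall>t. normal_form \<zeta> t 1 $ 3 = poly 0 t"
    unfolding normal_form_simps(1) by simp_all
  then show ?thesis using True exhaust_3[of j] by metis
next
  case False
  have "normal_form \<zeta> t l = normal_form \<zeta> 0 l" for t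
    using assms by (rule line_cases) (use False in \<open>auto simp: normal_form_simps\<close>)
  from this[THEN arg_cong[where f = "\<lambda>v. v $ j"]] show ?thesis
    by (intro exI[of _ "[:normal_form \<zeta> 0 l $ j:]"] allI) simp
qed

text \<open>These ratios recover the parameters \<open>\<zeta>\<close> and \<open>t\<close> from the class of a realization. They show that
  the components and the points of the moduli space are closed and that the parametrization is injective.\<close>

definition zeta_invariant :: "(nat \<Rightarrow> 'k::field ^ 3) \<Rightarrow> 'k" where
  "zeta_invariant M =
     bracket_ratio M (net_a 1) (net_a 0) (net_c 0) (net_c 1) (net_b 0) (net_b 1)"

definition slope_invariant :: "(nat \<Rightarrow> 'k::field ^ 3) \<Rightarrow> 'k" where
  "slope_invariant M =
     bracket_ratio M 1 (net_c 0) (net_b 0) (net_b 1) (net_a 0) (net_a 1)"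

lemma invariants_of_normal_form:
  fixes \<zeta> t :: "'k::field_char_0"
  assumes "fifth_root_polynomial \<zeta> = 0"
  shows "zeta_invariant (normal_form \<zeta> t) = \<zeta>" "slope_invariant (normal_form \<zeta> t) = t"
proof -
  note root = primitive_fifth_root[OF assms]
  have N: "normal_form \<zeta> t (net_a 0) = vector [1, 0, - 1]" "normal_form \<zeta> t (net_a 1) = vector [1, 0, - \<zeta>]"
    "normal_form \<zeta> t (net_b 0) = vector [0, 1, - 1]" "normal_form \<zeta> t (net_b 1) = vector [0, 1, - \<zeta>]"
    "normal_form \<zeta> t (net_c 0) = vector [1, - 1, 0]" "normal_form \<zeta> t (net_c 1) = vector [\<zeta>, - 1, 0]"
    using normal_form_simps(2-4)[of 0 \<zeta> t] normal_form_simps(2-4)[of 1 \<zeta> t] by simp_all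
  have "bracket (vector [1, 0, - \<zeta>]) (vector [1, - 1, 0]) (vector [\<zeta>, - 1, 0]) = \<zeta> * (1 - \<zeta>)"
    "bracket (vector [1, 0, - 1]) (vector [1, - 1, 0]) (vector [\<zeta>, - 1, 0]) = 1 - \<zeta>"
    "bracket (vector [1, 0, - \<zeta>]) (vector [0, 1, - 1]) (vector [0, 1, - \<zeta>]) = 1 - \<zeta>"
    "bracket (vector [1, 0, - 1]) (vector [0, 1, - 1]) (vector [0, 1, - \<zeta>]) = 1 - \<zeta>"
    by (simp_all add: bracket_vector algebra_simps)
  then show "zeta_invariant (normal_form \<zeta> t) = \<zeta>"
    unfolding zeta_invariant_def bracket_ratio_def N using root(2) by simp
  have "bracket (vector [x, - 1, 0]) (vector [0, 1, - 1]) (vector [0, 1, - \<zeta>]) = x * (1 - \<zeta>)"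
    "bracket (vector [x, - 1, 0]) (vector [1, 0, - 1]) (vector [1, 0, - \<zeta>]) = 1 - \<zeta>" for x
    by (simp_all add: bracket_vector algebra_simps)
  then show "slope_invariant (normal_form \<zeta> t) = t"
    unfolding slope_invariant_def bracket_ratio_def N normal_form_simps(1) using root(2) by simp
qed

lemma invariants_proj_equiv:
  assumes "proj_equiv matroid_16_38 M N"
  shows "zeta_invariant N = zeta_invariant M" "slope_invariant N = slope_invariant M"
  unfolding zeta_invariant_def slope_invariant_def
  by (rule bracket_ratio_proj_equiv[OF assms], simp add: lines_matroid)+

lemma closedin_level_sets_of_invariants:
  fixes \<kappa> :: "'k::field"
  shows "closedin (moduli_topology matroid_16_38)
      (moduli_class matroid_16_38 ` {M \<in> realizations matroid_16_38. zeta_invariant M = \<kappa>})"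
    "closedin (moduli_topology matroid_16_38)
      (moduli_class matroid_16_38 ` {M \<in> realizations matroid_16_38. slope_invariant M = \<kappa>})"
proof -
  let ?L = matroid_16_38
  have pencil: "\<not> concurrent ?L l i j" if "S \<in> points ?L" "i \<in> S" "j \<in> S" "i \<noteq> j" "l \<notin> S" for S l i j
    using concurrent_iff[OF rank_three_matroid_16_38 that(1-4)] that(5) concurrent_permute[of ?L] by blast
  have "\<not> concurrent ?L (net_a 0) (net_c 0) (net_c 1)" by (rule pencil[OF point_c]) (simp_all add: net_images)
  moreover have "\<not> concurrent ?L (net_a 1) (net_b 0) (net_b 1)" by (rule pencil[OF point_b]) (simp_all add: net_images)
  ultimately show "closedin (moduli_topology ?L)
      (moduli_class ?L ` {M \<in> realizations ?L. zeta_invariant M = \<kappa>})"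
    unfolding zeta_invariant_def
    by (intro closedin_level_set_of_bracket_ratio[OF rank_three_matroid_16_38]) (simp_all add: lines_matroid)
  have "\<not> concurrent ?L (net_c 0) (net_b 0) (net_b 1)" by (rule pencil[OF point_b]) (simp_all add: net_images)
  moreover have "\<not> concurrent ?L 1 (net_a 0) (net_a 1)" by (rule pencil[OF point_a]) (simp_all add: net_images)
  ultimately show "closedin (moduli_topology ?L)
      (moduli_class ?L ` {M \<in> realizations ?L. slope_invariant M = \<kappa>})"
    unfolding slope_invariant_def
    by (intro closedin_level_set_of_bracket_ratio[OF rank_three_matroid_16_38]) (simp_all add: lines_matroid)
qed

text \<open>Each root \<open>\<zeta>\<close> contributes a component parametrized by the \<open>t\<close> for which the normal form is a
  realization. A closed set pulls back to the common zeros of polynomials in \<open>t\<close>, so it contains the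
  component or meets it in finitely many points.\<close>

lemma moduli_dim_matroid_16_38: "moduli_dim TYPE(complex) matroid_16_38 = 1"
proof -
  let ?L = matroid_16_38
  let ?R = "realizations ?L :: (nat \<Rightarrow> complex ^ 3) set"
  let ?cl = "moduli_class ?L :: (nat \<Rightarrow> complex ^ 3) \<Rightarrow> _"
  define roots where "roots = {\<zeta> :: complex. fifth_root_polynomial \<zeta> = 0}"
  define D where "D \<zeta> = {t. normal_form \<zeta> t \<in> ?R}" for \<zeta>
  define V where "V \<zeta> = ?cl ` normal_form \<zeta> ` D \<zeta>" for \<zeta>
  note class_eq = moduli_class_eq_iff[OF rank_three_matroid_16_38]
  have normalize: "\<exists>\<zeta>\<in>roots. \<exists>t\<in>D \<zeta>. proj_equiv ?L M (normal_form \<zeta> t)" if "M \<in> ?R" for M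
  proof -
    have M: "represents ?L M" using that realizations_iff[OF rank_three_matroid_16_38] by blast
    obtain \<zeta> t where z: "fifth_root_polynomial \<zeta> = 0" "proj_equiv ?L M (normal_form \<zeta> t)"
      using normal_form_exists[OF M] by blast
    then have "normal_form \<zeta> t \<in> ?R"
      using represents_proj_equiv M realizations_iff[OF rank_three_matroid_16_38] normal_form_in_matrices
      by blast
    then show ?thesis using z by (auto simp: roots_def D_def)
  qed
  have V_eq: "V \<zeta> = ?cl ` {M \<in> ?R. zeta_invariant M = \<zeta>}" if "\<zeta> \<in> roots" for \<zeta>
  proof
    show "V \<zeta> \<subseteq> ?cl ` {M \<in> ?R. zeta_invariant M = \<zeta>}"
      using that by (auto simp: V_def D_def roots_def invariants_of_normal_form)
    show "?cl ` {M \<in> ?R. zeta_invariant M = \<zeta>} \<subseteq> V \<zeta>"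
    proof
      fix X assume "X \<in> ?cl ` {M \<in> ?R. zeta_invariant M = \<zeta>}"
      then obtain M where M: "M \<in> ?R" "zeta_invariant M = \<zeta>" "X = ?cl M" by auto
      then obtain \<zeta>' t where z: "\<zeta>' \<in> roots" "t \<in> D \<zeta>'" "proj_equiv ?L M (normal_form \<zeta>' t)"
        using normalize by blast
      then have "\<zeta>' = \<zeta>"
        using invariants_proj_equiv(1)[OF z(3)] invariants_of_normal_form(1)[of \<zeta>' t] M
        by (simp add: roots_def)
      moreover have "X = ?cl (normal_form \<zeta>' t)"
        using class_eq[of M "normal_form \<zeta>' t"] M z by (simp add: D_def)
      ultimately show "X \<in> V \<zeta>" using z by (auto simp: V_def)
    qed
  qed
  have inj: "inj_on (\<lambda>t. ?cl (normal_form \<zeta> t)) (D \<zeta>)" if "\<zeta> \<in> roots" for \<zeta>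
  proof (rule inj_onI)
    fix t u assume "t \<in> D \<zeta>" "u \<in> D \<zeta>" "?cl (normal_form \<zeta> t) = ?cl (normal_form \<zeta> u)"
    then have "proj_equiv ?L (normal_form \<zeta> t) (normal_form \<zeta> u)"
      using class_eq[of "normal_form \<zeta> t" "normal_form \<zeta> u"] by (simp add: D_def)
    then have "slope_invariant (normal_form \<zeta> u) = slope_invariant (normal_form \<zeta> t)"
      by (rule invariants_proj_equiv)
    then show "t = u" using that by (simp add: roots_def invariants_of_normal_form)
  qed
  have fin: "finite {z :: complex. z ^ 5 = 1}" by (rule finite_roots_unity) simp
  have infinite_D: "infinite (D \<zeta>)" if "\<zeta> \<in> roots" for \<zeta>
  proof -
    have "UNIV - ({0} \<union> {z. z ^ 5 = 1}) \<subseteq> D \<zeta>"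
      using that represents_normal_form[of \<zeta>] realizations_iff[OF rank_three_matroid_16_38] normal_form_in_matrices
      by (auto simp: D_def roots_def)
    moreover have "infinite (UNIV - ({0} \<union> {z :: complex. z ^ 5 = 1}))"
      using fin by (intro Diff_infinite_finite) (simp_all add: infinite_UNIV_char_0)
    ultimately show ?thesis by (rule infinite_super)
  qed
  have "krull_dim (moduli_topology ?L :: (nat \<Rightarrow> complex ^ 3) set set topology) = 1"
  proof (rule krull_dim_finite_union_cofinite[where I = roots and V = V])
    show "topspace (moduli_topology ?L) = (\<Union>\<zeta>\<in>roots. V \<zeta>)"
    proof -
      have "?cl M \<in> (\<Union>\<zeta>\<in>roots. V \<zeta>)" if M: "M \<in> ?R" for M
      proof -
        obtain \<zeta> t where z: "\<zeta> \<in> roots" "t \<in> D \<zeta>" "proj_equiv ?L M (normal_form \<zeta> t)"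
          using normalize[OF M] by blast
        then have "?cl M = ?cl (normal_form \<zeta> t)"
          using class_eq[of M "normal_form \<zeta> t"] M by (simp add: D_def)
        then show ?thesis using z by (auto simp: V_def)
      qed
      then show ?thesis
        unfolding topspace_moduli_topology moduli_space_eq by (auto simp: V_def D_def)
    qed
    have "roots \<subseteq> {z. z ^ 5 = 1}" by (auto simp: roots_def primitive_fifth_root(1))
    then show "finite roots" using fin by (rule finite_subset)
    show "roots \<noteq> {}"
    proof -
      have "card {z :: complex. z ^ 5 = 1} = 5" by (rule card_roots_unity_eq) simp
      then have "\<not> {z :: complex. z ^ 5 = 1} \<subseteq> {1}"
        using card_mono[of "{1 :: complex}" "{z. z ^ 5 = 1}"] by auto
      then obtain z :: complex where z: "z ^ 5 = 1" "z \<noteq> 1" by auto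
      have "z ^ 5 - 1 = (z - 1) * fifth_root_polynomial z"
        by (simp add: fifth_root_polynomial_def algebra_simps power_numeral_reduce)
      then show ?thesis using z by (auto simp: roots_def)
    qed
    show "closedin (moduli_topology ?L) (V \<zeta>)" if "\<zeta> \<in> roots" for \<zeta>
      unfolding V_eq[OF that] by (rule closedin_level_sets_of_invariants)
    show "infinite (V \<zeta>)" if "\<zeta> \<in> roots" for \<zeta>
      using finite_imageD[OF _ inj[OF that]] infinite_D[OF that] unfolding V_def image_image by blast
    show "closedin (moduli_topology ?L) {X}" if X: "X \<in> topspace (moduli_topology ?L)"
      for X :: "(nat \<Rightarrow> complex ^ 3) set set"
    proof -
      obtain M where M: "M \<in> ?R" "X = ?cl M"
        using X unfolding topspace_moduli_topology moduli_space_eq by blast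
      then obtain \<zeta> t where z: "\<zeta> \<in> roots" "t \<in> D \<zeta>" "proj_equiv ?L M (normal_form \<zeta> t)"
        using normalize by blast
      have X_eq: "X = ?cl (normal_form \<zeta> t)"
        using class_eq[of M "normal_form \<zeta> t"] M z by (simp add: D_def)
      have inv: "zeta_invariant (normal_form \<zeta> t) = \<zeta>" "slope_invariant (normal_form \<zeta> t) = t"
        using z(1) by (simp_all add: roots_def invariants_of_normal_form)
      have single: "{X} = V \<zeta> \<inter> ?cl ` {M \<in> ?R. slope_invariant M = t}"
      proof
        show "{X} \<subseteq> V \<zeta> \<inter> ?cl ` {M \<in> ?R. slope_invariant M = t}"
          using X_eq z inv by (auto simp: V_def D_def)
        show "V \<zeta> \<inter> ?cl ` {M \<in> ?R. slope_invariant M = t} \<subseteq> {X}"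
        proof
          fix Y assume "Y \<in> V \<zeta> \<inter> ?cl ` {M \<in> ?R. slope_invariant M = t}"
          then obtain u N where u: "u \<in> D \<zeta>" "Y = ?cl (normal_form \<zeta> u)"
            and N: "N \<in> ?R" "slope_invariant N = t" "Y = ?cl N" by (auto simp: V_def)
          then have "proj_equiv ?L N (normal_form \<zeta> u)"
            using class_eq[of N "normal_form \<zeta> u"] by (simp add: D_def)
          then have "u = t"
            using invariants_proj_equiv(2) invariants_of_normal_form(2)[of \<zeta> u] z(1) N
            by (fastforce simp: roots_def)
          then show "Y \<in> {X}" using u X_eq by simp
        qed
      qed
      have "closedin (moduli_topology ?L) (V \<zeta>)"
        unfolding V_eq[OF z(1)] by (rule closedin_level_sets_of_invariants)
      then show ?thesis
        unfolding single by (rule closedin_Int) (rule closedin_level_sets_of_invariants)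
    qed
    show "finite (Z \<inter> V \<zeta>) \<or> V \<zeta> \<subseteq> Z" if \<zeta>: "\<zeta> \<in> roots" and Z: "closedin (moduli_topology ?L) Z"
      for \<zeta> and Z :: "(nat \<Rightarrow> complex ^ 3) set set set"
    proof -
      obtain F where F: "F \<subseteq> Collect (polynomial_map (lines ?L))"
        "{M \<in> ?R. ?cl M \<in> Z} = ?R \<inter> zero_locus (lines ?L) F"
        using Z unfolding closedin_moduli_topology by blast
      have in_Z: "?cl (normal_form \<zeta> t) \<in> Z \<longleftrightarrow> (\<forall>f\<in>F. f (normal_form \<zeta> t) = 0)" if t: "t \<in> D \<zeta>" for t
      proof -
        have "normal_form \<zeta> t \<in> ?R" using t by (simp add: D_def)
        then have "?cl (normal_form \<zeta> t) \<in> Z \<longleftrightarrow> normal_form \<zeta> t \<in> zero_locus (lines ?L) F"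
          using F(2) by blast
        then show ?thesis using normal_form_in_matrices[of \<zeta> t] by (simp add: zero_locus_def)
      qed
      show ?thesis
      proof (cases "\<forall>f\<in>F. \<forall>t. f (normal_form \<zeta> t) = 0")
        case True
        then show ?thesis using in_Z by (auto simp: V_def)
      next
        case False
        then obtain f t0 where f: "f \<in> F" "f (normal_form \<zeta> t0) \<noteq> 0" by blast
        have "polynomial_map (lines ?L) f" using F(1) f(1) by blast
        then have "\<exists>P. \<forall>t. f (normal_form \<zeta> t) = poly P t"
          by (rule polynomial_map_on_polynomial_curve) (rule normal_form_polynomial_curve)
        then obtain P where P: "\<And>t. f (normal_form \<zeta> t) = poly P t" by blast
        then have "P \<noteq> 0" using f(2) by auto
        then have "finite {t. poly P t = 0}" by (rule poly_roots_finite)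
        moreover have "Z \<inter> V \<zeta> \<subseteq> (\<lambda>t. ?cl (normal_form \<zeta> t)) ` {t. poly P t = 0}"
        proof
          fix X assume "X \<in> Z \<inter> V \<zeta>"
          then obtain t where t: "t \<in> D \<zeta>" "X = ?cl (normal_form \<zeta> t)" "X \<in> Z" by (auto simp: V_def)
          then have "poly P t = 0" using in_Z[OF t(1)] f(1) P[of t] by auto
          then show "X \<in> (\<lambda>t. ?cl (normal_form \<zeta> t)) ` {t. poly P t = 0}" using t(2) by blast
        qed
        ultimately show ?thesis by (meson finite_imageI finite_subset)
      qed
    qed
  qed
  then show ?thesis by (simp add: moduli_dim_def)
qed

lemma fifth_root_polynomial_real_positive: "fifth_root_polynomial (x :: real) > 0"
proof -
  have "fifth_root_polynomial x = (x\<^sup>2 + x / 2)\<^sup>2 + 3 / 4 * (x + 2 / 3)\<^sup>2 + 2 / 3"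
    by (simp add: fifth_root_polynomial_def power2_eq_square power_numeral_reduce field_simps)
  also have "\<dots> > 0" by (intro add_nonneg_pos add_nonneg_nonneg) simp_all
  finally show ?thesis .
qed

theorem mainTheorem3:
  shows "combinatorially_simplicial matroid_16_38 \<and>
    generation_number matroid_16_38 = 5 \<and>
    moduli_dim TYPE(complex) matroid_16_38 = 1 \<and>
    \<not> has_realization TYPE(real) matroid_16_38"
proof (intro conjI)
  show "\<not> has_realization TYPE(real) matroid_16_38"
  proof
    assume "has_realization TYPE(real) matroid_16_38"
    then obtain M :: "nat \<Rightarrow> real ^ 3" where "M \<in> realizations matroid_16_38"
      by (auto simp: has_realization_def)
    then have "represents matroid_16_38 M" using realizations_iff[OF rank_three_matroid_16_38] by blast
    then obtain \<zeta> :: real where "fifth_root_polynomial \<zeta> = 0" by (rule normal_form_exists)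
    then show False using fifth_root_polynomial_real_positive[of \<zeta>] by simp
  qed
qed (fact combinatorially_simplicial_matroid_16_38 generation_number_matroid_16_38 moduli_dim_matroid_16_38)+

end
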